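(* Let $G$ be an $\ell$-group, $D\subset\mathbb{C}$ an open subset, and $\varpi$ a $D$-holomorphic character of $G$. Let $\xi$ be a $\varpi$-equivariant meromorphic intertwining operator from $V$ to $W$ over $D$, where $V$ is a smooth representation and $W$ is a smooth admissible representation of $G$. Let $U\subseteq V$ be a sub-representation such that $\xi|_U$ is holomorphic at $s_0\in D$. Let $\delta:\mathrm{Hom}_G(U,W)\to\mathrm{Ext}^1_G(V/U,W)$ be the connecting homomorphism. Assume that $\varpi(s_0)=\varpi(s_0,\cdot)$ is the trivial character of $G$. Then: (1) The map $\mathrm{Res}_{s=s_0}\left(\frac{\varpi(s)-1}{s-s_0}\,\xi(s)\right)$ given by $$g\mapsto \mathrm{Res}_{s=s_0}\left(\frac{\varpi(s,g)-1}{s-s_0}\,\xi(s)\right)\in \mathrm{Hom}(V,W)$$ is a 1-cocycle from $V$ to $W$. (2) The class of $\delta(\xi|_U(s_0))$ in $\mathrm{Ext}^1_G(V/U,W)$ is represented by the 1-cocycle $\mathrm{Res}_{s=s_0}\left(\frac{\varpi(s)-1}{s-s_0}\,\xi(s)\right)$ (regarded as a 1-cocycle from $V/U$ to $W$).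
   Context: An $\ell$-group is a topological group that is Hausdorff, locally compact, totally disconnected and second-countable. Representations are on complex vector spaces; a smooth representation is admissible if $W^K$ is finite dimensional for every compact open subgroup $K$. $\mathrm{Ext}^i_G$ denotes Ext in the category of smooth representations of $G$. $G$ acts on $\mathrm{Hom}(V,W)$ by $(g\cdot f)(v)=g f(g^{-1}v)$. A $D$-holomorphic character of $G$ is a map $\varpi:D\times G\to\mathbb{C}^\times$ such that $\varpi(\cdot,g)$ is holomorphic on $D$ for every $g\in G$, and there is an open subgroup $K\subset G$ such that for every $s\in D$, $\varpi(s,\cdot):G\to\mathbb{C}^\times$ is a group homomorphism with $K$ in its kernel. A $\varpi$-equivariant meromorphic intertwining operator from $V$ to $W$ over $D$ is a map $\xi:D\times V\to W$ (meromorphic in $s$, so defined for $s$ outside its poles), with $\xi(s)=\xi(s,\cdot)$, such that: (i) $g\cdot\xi(s,v)=\varpi(s,g)\,\xi(s,g\cdot v)$ for all $g\in G$, $v\in V$; (ii) $\xi(s,\cdot)$ is linear for each $s$, and for every $v\in V$ there is an open subgroup $K$ of $G$ stabilizing $v$ such that $\varpi$ is trivial on $K$ and $\xi(\cdot,v)$ is a meromorphic function on $D$ with values in the finite-dimensional space $W^K$; (iii) there is a discrete subset $\Pi\subset D$ such that $\xi(\cdot,v)$ is holomorphic outside $\Pi$ for every $v\in V$, and at each point of $\Pi$ the orders of the poles are bounded uniformly in $v\in V$. Writing the Laurent expansion of a (linear operator valued) function at $s_0$ coefficientwise, with coefficients in $\mathrm{Hom}(V,W)$, $\mathrm{Res}_{s=s_0}$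 denotes the coefficient of $(s-s_0)^{-1}$. For smooth representations $A,B$ of $G$, a 1-cocycle from $A$ to $B$ is a map $\psi:G\times A\to B$, linear in $A$ and such that $\psi(\cdot,a)$ is locally constant on $G$ for each $a\in A$, satisfying $\psi(g_1g_2,a)=g_1\psi(g_2,g_1^{-1}a)+\psi(g_1,a)$; a 1-coboundary is such a map of the form $\psi(g,a)=g\eta(g^{-1}a)-\eta(a)$ for some $\eta\in\mathrm{Hom}(A,B)$. $\mathrm{Ext}^1_G(A,B)$ is identified with $Z^1(A,B)/B^1(A,B)$ (1-cocycles modulo 1-coboundaries), via the standard smooth injective resolution of $B$ by $G$-smooth vectors in locally constant functions $G^{i+1}\to B$. The connecting map $\delta$ is the one in the long exact sequence $0\to\mathrm{Hom}_G(V/U,W)\to\mathrm{Hom}_G(V,W)\to\mathrm{Hom}_G(U,W)\xrightarrow{\delta}\mathrm{Ext}^1_G(V/U,W)\to\cdots$. *)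

theory Defs
  imports
    "HOL-Analysis.Analysis"
    "HOL-Complex_Analysis.Complex_Analysis"
    "HOL-Algebra.Algebraic_Closure_Type"
begin

section \<open>Groups and smooth representations\<close>

definition l_group :: "('g, 'm) monoid_scheme \<Rightarrow> 'g topology \<Rightarrow> bool" where
  "l_group G T \<longleftrightarrow>
     group G \<and> topspace T = carrier G \<and>
     continuous_map (prod_topology T T) T (\<lambda>(x, y). x \<otimes>\<^bsub>G\<^esub> y) \<and>
     continuous_map T T (\<lambda>x. inv\<^bsub>G\<^esub> x) \<and>
     Hausdorff_space T \<and> locally_compact_space T \<and> second_countable T \<and>
     (\<forall>S. connectedin T S \<longrightarrow> (\<exists>x. S \<subseteq> {x}))"

definition open_subgroup :: "('g, 'm) monoid_scheme \<Rightarrow> 'g topology \<Rightarrow> 'g set \<Rightarrow> bool" where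
  "open_subgroup G T K \<longleftrightarrow> subgroup K G \<and> openin T K"

abbreviation complex_field :: "complex ring" where
  "complex_field \<equiv> ring_of_type_algebra"

text \<open>
  A representation is a complex vector space together with an action. The fields \<open>mult\<close> and
  \<open>one\<close>, which \<^type>\<open>module\<close> inherits from rings, are never used.
\<close>

record ('g, 'v) rep = "(complex, 'v) module" +
  act :: "'g \<Rightarrow> 'v \<Rightarrow> 'v"

definition lin_hom :: "(complex, 'a, 'm) module_scheme \<Rightarrow> (complex, 'b, 'n) module_scheme
    \<Rightarrow> ('a \<Rightarrow> 'b) set" where
  "lin_hom A B = {f \<in> carrier A \<rightarrow> carrier B.
     (\<forall>x\<in>carrier A. \<forall>y\<in>carrier A. f (x \<oplus>\<^bsub>A\<^esub> y) = f x \<oplus>\<^bsub>B\<^esub> f y) \<and>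
     (\<forall>a. \<forall>x\<in>carrier A. f (a \<odot>\<^bsub>A\<^esub> x) = a \<odot>\<^bsub>B\<^esub> f x)}"

definition representation :: "('g, 'm) monoid_scheme \<Rightarrow> ('g, 'v) rep \<Rightarrow> bool" where
  "representation G V \<longleftrightarrow>
     module complex_field V \<and>
     (\<forall>g\<in>carrier G. act V g \<in> lin_hom V V) \<and>
     (\<forall>v\<in>carrier V. act V \<one>\<^bsub>G\<^esub> v = v) \<and>
     (\<forall>g\<in>carrier G. \<forall>h\<in>carrier G. \<forall>v\<in>carrier V.
        act V (g \<otimes>\<^bsub>G\<^esub> h) v = act V g (act V h v))"

definition G_hom :: "('g, 'm) monoid_scheme \<Rightarrow> ('g, 'a) rep \<Rightarrow> ('g, 'b) rep \<Rightarrow> ('a \<Rightarrow> 'b) set" where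
  "G_hom G A B = {f \<in> lin_hom A B.
     \<forall>g\<in>carrier G. \<forall>x\<in>carrier A. f (act A g x) = act B g (f x)}"

definition fixed_vectors :: "('g, 'v) rep \<Rightarrow> 'g set \<Rightarrow> 'v set" where
  "fixed_vectors V K = {v \<in> carrier V. \<forall>k\<in>K. act V k v = v}"

definition smooth_vectors :: "('g, 'm) monoid_scheme \<Rightarrow> 'g topology \<Rightarrow> ('g, 'v) rep \<Rightarrow> 'v set" where
  "smooth_vectors G T V = {v. \<exists>K. open_subgroup G T K \<and> v \<in> fixed_vectors V K}"

definition smooth_rep :: "('g, 'm) monoid_scheme \<Rightarrow> 'g topology \<Rightarrow> ('g, 'v) rep \<Rightarrow> bool" where
  "smooth_rep G T V \<longleftrightarrow> representation G V \<and> carrier V \<subseteq> smooth_vectors G T V"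

definition lincomb :: "('g, 'v) rep \<Rightarrow> ('v \<Rightarrow> complex) \<Rightarrow> 'v set \<Rightarrow> 'v" where
  "lincomb V c B = (\<Oplus>\<^bsub>V\<^esub>b\<in>B. c b \<odot>\<^bsub>V\<^esub> b)"

definition fin_dim :: "('g, 'v) rep \<Rightarrow> 'v set \<Rightarrow> bool" where
  "fin_dim V E \<longleftrightarrow> (\<exists>B. finite B \<and> B \<subseteq> E \<and> (\<forall>w\<in>E. \<exists>c. w = lincomb V c B))"

definition fin_basis :: "('g, 'v) rep \<Rightarrow> 'v set \<Rightarrow> 'v set \<Rightarrow> bool" where
  "fin_basis V E B \<longleftrightarrow>
     finite B \<and> B \<subseteq> E \<and> (\<forall>w\<in>E. \<exists>!c. c \<in> B \<rightarrow>\<^sub>E UNIV \<and> w = lincomb V c B)"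

definition admissible_rep :: "('g, 'm) monoid_scheme \<Rightarrow> 'g topology \<Rightarrow> ('g, 'v) rep \<Rightarrow> bool" where
  "admissible_rep G T V \<longleftrightarrow> smooth_rep G T V \<and>
     (\<forall>K. open_subgroup G T K \<and> compactin T K \<longrightarrow> fin_dim V (fixed_vectors V K))"

definition is_subrep :: "('g, 'm) monoid_scheme \<Rightarrow> ('g, 'v) rep \<Rightarrow> 'v set \<Rightarrow> bool" where
  "is_subrep G V U \<longleftrightarrow>
     submodule U complex_field V \<and> (\<forall>g\<in>carrier G. \<forall>u\<in>U. act V g u \<in> U)"

definition sub_rep :: "('g, 'v) rep \<Rightarrow> 'v set \<Rightarrow> ('g, 'v) rep" where
  "sub_rep V U = V\<lparr>carrier := U\<rparr>"

text \<open>\<open>V/U\<close>, with elements the cosets \<open>U +> v\<close>; compare \<^const>\<open>FactRing\<close>.\<close>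

definition quot_rep :: "('g, 'v) rep \<Rightarrow> 'v set \<Rightarrow> ('g, 'v set) rep" where
  "quot_rep V U =
     \<lparr> carrier = a_rcosets\<^bsub>V\<^esub> U, mult = undefined, one = undefined,
       zero = U, add = set_add V,
       smult = (\<lambda>a Y. \<Union>x\<in>Y. U +>\<^bsub>V\<^esub> (a \<odot>\<^bsub>V\<^esub> x)),
       act = (\<lambda>g Y. \<Union>x\<in>Y. U +>\<^bsub>V\<^esub> act V g x) \<rparr>"


section \<open>Meromorphic families of vectors\<close>

text \<open>
  Vector-valued functions are handled through coordinates in a finite-dimensional subspace. As
  usual a meromorphic function is only a function off its poles: its value at a pole is arbitrary,
  and at every other point it is required to be holomorphic (no removable singularities).
\<close>

definition vec_holomorphic_at ::
    "('g, 'w) rep \<Rightarrow> (complex \<Rightarrow> 'w) \<Rightarrow> complex \<Rightarrow> bool" where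
  "vec_holomorphic_at W f z \<longleftrightarrow>
     (\<exists>B c. finite B \<and> B \<subseteq> carrier W \<and> (\<forall>b\<in>B. c b analytic_on {z}) \<and>
            (\<forall>\<^sub>F s in nhds z. f s = lincomb W (\<lambda>b. c b s) B))"

definition vec_meromorphic_on ::
    "('g, 'w) rep \<Rightarrow> 'w set \<Rightarrow> (complex \<Rightarrow> 'w) \<Rightarrow> complex set \<Rightarrow> bool" where
  "vec_meromorphic_on W E f D \<longleftrightarrow>
     (\<exists>B c. fin_basis W E B \<and> (\<forall>b\<in>B. c b nicely_meromorphic_on D) \<and>
            (\<forall>s\<in>D. (\<exists>b\<in>B. is_pole (c b) s) \<or> f s = lincomb W (\<lambda>b. c b s) B))"

definition has_vec_laurent ::
    "('g, 'w) rep \<Rightarrow> (complex \<Rightarrow> 'w) \<Rightarrow> complex \<Rightarrow> (int \<Rightarrow> 'w) \<Rightarrow> bool" where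
  "has_vec_laurent W f z a \<longleftrightarrow>
     (\<exists>B c F. finite B \<and> B \<subseteq> carrier W \<and>
        (\<forall>b\<in>B. (\<lambda>t. c b (z + t)) has_laurent_expansion F b) \<and>
        (\<forall>\<^sub>F s in at z. f s = lincomb W (\<lambda>b. c b s) B) \<and>
        (\<forall>k. a k = lincomb W (\<lambda>b. fls_nth (F b) k) B))"

definition laurent_coeff ::
    "('g, 'w) rep \<Rightarrow> (complex \<Rightarrow> 'w) \<Rightarrow> complex \<Rightarrow> int \<Rightarrow> 'w" where
  "laurent_coeff W f z = (THE a. has_vec_laurent W f z a)"

definition holomorphic_character ::
    "('g, 'm) monoid_scheme \<Rightarrow> 'g topology \<Rightarrow> complex set \<Rightarrow> (complex \<Rightarrow> 'g \<Rightarrow> complex) \<Rightarrow> bool" where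
  "holomorphic_character G T D \<omega> \<longleftrightarrow>
     (\<forall>g\<in>carrier G. (\<lambda>s. \<omega> s g) holomorphic_on D) \<and>
     (\<forall>s\<in>D. \<forall>g\<in>carrier G. \<omega> s g \<noteq> 0) \<and>
     (\<exists>K. open_subgroup G T K \<and>
        (\<forall>s\<in>D. (\<forall>g\<in>carrier G. \<forall>h\<in>carrier G. \<omega> s (g \<otimes>\<^bsub>G\<^esub> h) = \<omega> s g * \<omega> s h) \<and>
               (\<forall>k\<in>K. \<omega> s k = 1)))"

text \<open>
  The identities for \<open>\<xi> s\<close> (equivariance, additivity, homogeneity) are imposed exactly where all
  the vectors \<open>\<xi> s v\<close> occurring in them are defined, i.e. where \<open>s\<close> is not a pole.
\<close>

definition meromorphic_intertwiner ::
    "('g, 'm) monoid_scheme \<Rightarrow> 'g topology \<Rightarrow> ('g, 'v) rep \<Rightarrow> ('g, 'w) rep \<Rightarrow> complex set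
      \<Rightarrow> (complex \<Rightarrow> 'g \<Rightarrow> complex) \<Rightarrow> (complex \<Rightarrow> 'v \<Rightarrow> 'w) \<Rightarrow> bool" where
  "meromorphic_intertwiner G T V W D \<omega> \<xi> \<longleftrightarrow>
     (let hol = (\<lambda>s v. vec_holomorphic_at W (\<lambda>s'. \<xi> s' v) s) in
       (\<forall>s\<in>D. \<forall>g\<in>carrier G. \<forall>v\<in>carrier V. hol s v \<and> hol s (act V g v) \<longrightarrow>
          act W g (\<xi> s v) = \<omega> s g \<odot>\<^bsub>W\<^esub> \<xi> s (act V g v)) \<and>
       (\<forall>s\<in>D. \<forall>v\<in>carrier V. \<forall>v'\<in>carrier V. hol s v \<and> hol s v' \<and> hol s (v \<oplus>\<^bsub>V\<^esub> v') \<longrightarrow>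
          \<xi> s (v \<oplus>\<^bsub>V\<^esub> v') = \<xi> s v \<oplus>\<^bsub>W\<^esub> \<xi> s v') \<and>
       (\<forall>s\<in>D. \<forall>a. \<forall>v\<in>carrier V. hol s v \<and> hol s (a \<odot>\<^bsub>V\<^esub> v) \<longrightarrow>
          \<xi> s (a \<odot>\<^bsub>V\<^esub> v) = a \<odot>\<^bsub>W\<^esub> \<xi> s v) \<and>
       (\<forall>v\<in>carrier V. \<exists>K. open_subgroup G T K \<and> v \<in> fixed_vectors V K \<and>
          (\<forall>s\<in>D. \<forall>k\<in>K. \<omega> s k = 1) \<and>
          vec_meromorphic_on W (fixed_vectors W K) (\<lambda>s. \<xi> s v) D) \<and>
       (\<exists>P. P \<subseteq> D \<and> discrete P \<and>
          (\<forall>v\<in>carrier V. \<forall>s\<in>D - P. hol s v) \<and>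
          (\<forall>p\<in>P. \<exists>n::nat. \<forall>v\<in>carrier V. \<forall>k < - int n.
             laurent_coeff W (\<lambda>s. \<xi> s v) p k = \<zero>\<^bsub>W\<^esub>)))"

definition residue_cocycle ::
    "('g, 'w) rep \<Rightarrow> (complex \<Rightarrow> 'g \<Rightarrow> complex) \<Rightarrow> (complex \<Rightarrow> 'v \<Rightarrow> 'w) \<Rightarrow> complex
      \<Rightarrow> 'g \<Rightarrow> 'v \<Rightarrow> 'w" where
  "residue_cocycle W \<omega> \<xi> s\<^sub>0 g v =
     laurent_coeff W (\<lambda>s. ((\<omega> s g - 1) / (s - s\<^sub>0)) \<odot>\<^bsub>W\<^esub> \<xi> s v) s\<^sub>0 (-1)"


section \<open>Cocycles\<close>

definition locally_constant :: "'x topology \<Rightarrow> ('x \<Rightarrow> 'b) \<Rightarrow> bool" where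
  "locally_constant Y f \<longleftrightarrow>
     (\<forall>x\<in>topspace Y. \<exists>N. openin Y N \<and> x \<in> N \<and> (\<forall>y\<in>N. f y = f x))"

text \<open>
  Maps are only relevant on carriers; \<open>coh1_rel\<close> therefore also identifies cocycles that agree
  there (take \<open>\<eta> = 0\<close>). The same applies to \<open>ext1_rel\<close> below.
\<close>

definition cocycles1 :: "('g, 'm) monoid_scheme \<Rightarrow> 'g topology \<Rightarrow> ('g, 'a) rep \<Rightarrow> ('g, 'b) rep
    \<Rightarrow> ('g \<Rightarrow> 'a \<Rightarrow> 'b) set" where
  "cocycles1 G T A B = {\<psi>.
     (\<forall>g\<in>carrier G. \<psi> g \<in> lin_hom A B) \<and>
     (\<forall>a\<in>carrier A. locally_constant T (\<lambda>g. \<psi> g a)) \<and>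
     (\<forall>g\<in>carrier G. \<forall>h\<in>carrier G. \<forall>a\<in>carrier A.
        \<psi> (g \<otimes>\<^bsub>G\<^esub> h) a = act B g (\<psi> h (act A (inv\<^bsub>G\<^esub> g) a)) \<oplus>\<^bsub>B\<^esub> \<psi> g a)}"

definition coboundary1 :: "('g, 'm) monoid_scheme \<Rightarrow> ('g, 'a) rep \<Rightarrow> ('g, 'b) rep
    \<Rightarrow> ('a \<Rightarrow> 'b) \<Rightarrow> 'g \<Rightarrow> 'a \<Rightarrow> 'b" where
  "coboundary1 G A B \<eta> g a = act B g (\<eta> (act A (inv\<^bsub>G\<^esub> g) a)) \<ominus>\<^bsub>B\<^esub> \<eta> a"

definition coh1_rel :: "('g, 'm) monoid_scheme \<Rightarrow> 'g topology \<Rightarrow> ('g, 'a) rep \<Rightarrow> ('g, 'b) rep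
    \<Rightarrow> (('g \<Rightarrow> 'a \<Rightarrow> 'b) \<times> ('g \<Rightarrow> 'a \<Rightarrow> 'b)) set" where
  "coh1_rel G T A B = {(\<psi>, \<psi>'). \<psi> \<in> cocycles1 G T A B \<and> \<psi>' \<in> cocycles1 G T A B \<and>
     (\<exists>\<eta>\<in>lin_hom A B. \<forall>g\<in>carrier G. \<forall>a\<in>carrier A.
        \<psi>' g a = \<psi> g a \<oplus>\<^bsub>B\<^esub> coboundary1 G A B \<eta> g a)}"

definition coh1_class :: "('g, 'm) monoid_scheme \<Rightarrow> 'g topology \<Rightarrow> ('g, 'a) rep \<Rightarrow> ('g, 'b) rep
    \<Rightarrow> ('g \<Rightarrow> 'a \<Rightarrow> 'b) \<Rightarrow> ('g \<Rightarrow> 'a \<Rightarrow> 'b) set" where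
  "coh1_class G T A B \<psi> = coh1_rel G T A B `` {\<psi>}"


section \<open>Ext via the standard resolution\<close>

text \<open>
  \<open>std_res G T B i\<close> is the space of smooth vectors in the locally constant functions
  \<open>G\<^sup>i\<^sup>+\<^sup>1 \<rightarrow> B\<close>, where \<open>(g \<phi>)(x\<^sub>0,\<dots>,x\<^sub>i) = g \<phi>(g\<inverse>x\<^sub>0,\<dots>,g\<inverse>x\<^sub>i)\<close>. Together with the constants
  \<open>std_aug\<close> and the alternating sums \<open>std_diff\<close> it forms the standard smooth injective resolution
  \<open>0 \<rightarrow> B \<rightarrow> I\<^sup>0 \<rightarrow> I\<^sup>1 \<rightarrow> \<dots>\<close>.
\<close>

definition gpow :: "('g, 'm) monoid_scheme \<Rightarrow> nat \<Rightarrow> (nat \<Rightarrow> 'g) set" where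
  "gpow G i = {..i} \<rightarrow>\<^sub>E carrier G"

definition loc_const_rep :: "('g, 'm) monoid_scheme \<Rightarrow> 'g topology \<Rightarrow> ('g, 'b) rep \<Rightarrow> nat
    \<Rightarrow> ('g, (nat \<Rightarrow> 'g) \<Rightarrow> 'b) rep" where
  "loc_const_rep G T B i =
     \<lparr> carrier = {\<phi> \<in> gpow G i \<rightarrow>\<^sub>E carrier B.
                    locally_constant (product_topology (\<lambda>_. T) {..i}) \<phi>},
       mult = undefined, one = undefined,
       zero = (\<lambda>x\<in>gpow G i. \<zero>\<^bsub>B\<^esub>),
       add = (\<lambda>\<phi> \<theta>. \<lambda>x\<in>gpow G i. \<phi> x \<oplus>\<^bsub>B\<^esub> \<theta> x),
       smult = (\<lambda>a \<phi>. \<lambda>x\<in>gpow G i. a \<odot>\<^bsub>B\<^esub> \<phi> x),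
       act = (\<lambda>g \<phi>. \<lambda>x\<in>gpow G i. act B g (\<phi> (\<lambda>k\<in>{..i}. inv\<^bsub>G\<^esub> g \<otimes>\<^bsub>G\<^esub> x k))) \<rparr>"

definition std_res :: "('g, 'm) monoid_scheme \<Rightarrow> 'g topology \<Rightarrow> ('g, 'b) rep \<Rightarrow> nat
    \<Rightarrow> ('g, (nat \<Rightarrow> 'g) \<Rightarrow> 'b) rep" where
  "std_res G T B i = sub_rep (loc_const_rep G T B i) (smooth_vectors G T (loc_const_rep G T B i))"

definition std_aug :: "('g, 'm) monoid_scheme \<Rightarrow> 'b \<Rightarrow> (nat \<Rightarrow> 'g) \<Rightarrow> 'b" where
  "std_aug G b = (\<lambda>x\<in>gpow G 0. b)"

definition std_diff :: "('g, 'm) monoid_scheme \<Rightarrow> ('g, 'b) rep \<Rightarrow> nat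
    \<Rightarrow> ((nat \<Rightarrow> 'g) \<Rightarrow> 'b) \<Rightarrow> (nat \<Rightarrow> 'g) \<Rightarrow> 'b" where
  "std_diff G B i \<phi> = (\<lambda>x\<in>gpow G (Suc i).
     \<Oplus>\<^bsub>B\<^esub>j\<in>{..Suc i}. ((-1) ^ j) \<odot>\<^bsub>B\<^esub> \<phi> (\<lambda>k\<in>{..i}. if k < j then x k else x (Suc k)))"

definition ext1_cocycles :: "('g, 'm) monoid_scheme \<Rightarrow> 'g topology \<Rightarrow> ('g, 'a) rep \<Rightarrow> ('g, 'b) rep
    \<Rightarrow> ('a \<Rightarrow> (nat \<Rightarrow> 'g) \<Rightarrow> 'b) set" where
  "ext1_cocycles G T A B = {F \<in> G_hom G A (std_res G T B 1).
     \<forall>a\<in>carrier A. std_diff G B 1 (F a) = \<zero>\<^bsub>std_res G T B 2\<^esub>}"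

definition ext1_rel :: "('g, 'm) monoid_scheme \<Rightarrow> 'g topology \<Rightarrow> ('g, 'a) rep \<Rightarrow> ('g, 'b) rep
    \<Rightarrow> (('a \<Rightarrow> (nat \<Rightarrow> 'g) \<Rightarrow> 'b) \<times> ('a \<Rightarrow> (nat \<Rightarrow> 'g) \<Rightarrow> 'b)) set" where
  "ext1_rel G T A B = {(F, F'). F \<in> ext1_cocycles G T A B \<and> F' \<in> ext1_cocycles G T A B \<and>
     (\<exists>E\<in>G_hom G A (std_res G T B 0). \<forall>a\<in>carrier A.
        F' a = F a \<oplus>\<^bsub>std_res G T B 1\<^esub> std_diff G B 0 (E a))}"

definition ext1 :: "('g, 'm) monoid_scheme \<Rightarrow> 'g topology \<Rightarrow> ('g, 'a) rep \<Rightarrow> ('g, 'b) rep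
    \<Rightarrow> ('a \<Rightarrow> (nat \<Rightarrow> 'g) \<Rightarrow> 'b) set set" where
  "ext1 G T A B = ext1_cocycles G T A B // ext1_rel G T A B"

text \<open>
  The identification of \<^const>\<open>ext1\<close> with 1-cocycles modulo 1-coboundaries is induced by
  \<open>F \<mapsto> ((g, a) \<mapsto> F(a)(1, g))\<close>; the union is over a family of equal classes.
\<close>

definition ext1_ident :: "('g, 'm) monoid_scheme \<Rightarrow> 'g topology \<Rightarrow> ('g, 'a) rep \<Rightarrow> ('g, 'b) rep
    \<Rightarrow> ('a \<Rightarrow> (nat \<Rightarrow> 'g) \<Rightarrow> 'b) set \<Rightarrow> ('g \<Rightarrow> 'a \<Rightarrow> 'b) set" where
  "ext1_ident G T A B Y =
     (\<Union>F\<in>Y. coh1_class G T A B (\<lambda>g a. F a (\<lambda>k\<in>{..1}. if k = 0 then \<one>\<^bsub>G\<^esub> else g)))"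

text \<open>
  The connecting map \<open>Hom\<^sub>G(U, W) \<rightarrow> Ext\<^sup>1(V/U, W)\<close> given by the snake lemma for
  \<open>0 \<rightarrow> Hom\<^sub>G(V/U, I\<^sup>\<bullet>) \<rightarrow> Hom\<^sub>G(V, I\<^sup>\<bullet>) \<rightarrow> Hom\<^sub>G(U, I\<^sup>\<bullet>) \<rightarrow> 0\<close>: view \<open>f\<close> as a map into \<open>I\<^sup>0\<close>, extend it
  to \<open>E\<close> on \<open>V\<close>, apply the differential, and descend to \<open>F\<close> on \<open>V/U\<close>.
\<close>

definition connecting_hom :: "('g, 'm) monoid_scheme \<Rightarrow> 'g topology \<Rightarrow> ('g, 'v) rep \<Rightarrow> 'v set
    \<Rightarrow> ('g, 'w) rep \<Rightarrow> ('v \<Rightarrow> 'w) \<Rightarrow> ('v set \<Rightarrow> (nat \<Rightarrow> 'g) \<Rightarrow> 'w) set" where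
  "connecting_hom G T V U W f =
     (THE Y. Y \<in> ext1 G T (quot_rep V U) W \<and>
        (\<exists>E\<in>G_hom G V (std_res G T W 0). \<exists>F\<in>Y.
           (\<forall>u\<in>U. E u = std_aug G (f u)) \<and>
           (\<forall>v\<in>carrier V. F (U +>\<^bsub>V\<^esub> v) = std_diff G W 0 (E v))))"

end

theory Submission imports Defs
begin

text \<open>
  Let \<open>\<eta>(v)\<close> be the constant term of \<open>\<xi>(\<cdot>, v)\<close> at \<open>s\<^sub>0\<close>. Comparing constant terms in
  \<open>g \<xi>(s, g\<inverse>v) = \<omega>(s, g) \<xi>(s, v) = (\<omega>(s, g) - 1) \<xi>(s, v) + \<xi>(s, v)\<close> shows that the residue cocycle
  equals \<open>g \<eta>(g\<inverse>v) - \<eta>(v)\<close>, i.e. it is the coboundary of \<open>\<eta>\<close> on \<open>V\<close>. On \<open>U\<close> the map \<open>\<eta>\<close> is \<open>\<xi>(s\<^sub>0)\<close>,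
  so \<open>E(v)(x) = x \<eta>(x\<inverse>v)\<close> extends \<open>\<xi>(s\<^sub>0)\<close> to a \<open>G\<close>-map from \<open>V\<close> to \<open>I\<^sup>0\<close>, and the value of its
      differential
  at \<open>(1, g)\<close> is that same coboundary.

  The exceptional set \<open>P\<close> of an intertwining operator is only discrete in itself and may accumulate at
  \<open>s\<^sub>0\<close>. The identities for \<open>\<xi>\<close> are therefore used on punctured neighbourhoods of \<open>s\<^sub>0\<close> depending on the
  vectors involved, whose individual poles are isolated.
\<close>

section \<open>Linear combinations\<close>

text \<open>Values of \<open>\<xi>\<close> are described only through combinations of finitely many
  vectors, and the finite set varies with the vector v. Laurent coefficients are therefore first
  shown to be independent of the finite set, which may be linearly dependent; after that they
  inherit every identity that holds near \<open>s\<^sub>0\<close>. The map \<eta> is linear on all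
  of V even where \<xi> has a pole, and the residue measures exactly its failure to be equivariant.
  The snake lemma usually obtains the extension to V from injectivity of I^0. Here Frobenius
  reciprocity, applied to \<eta>, writes it down. Triviality of the character at
  \<open>s\<^sub>0\<close> makes \<open>\<xi> s\<^sub>0\<close> equivariant on U, so E is constant
  in x on U and its differential vanishes there. The residue is a coboundary on V, yet its class on
  V/U may be nonzero: \<eta> does not vanish on U in general, so it does not descend. Since the
  connecting map is a definite description, it also has to be shown that every other extension leads
  to the same class.\<close>

lemma complex_field_simps [simp]:
  "carrier complex_field = UNIV" "a \<oplus>\<^bsub>complex_field\<^esub> b = a + b"
  "a \<otimes>\<^bsub>complex_field\<^esub> b = a * b" "\<zero>\<^bsub>complex_field\<^esub> = 0" "\<one>\<^bsub>complex_field\<^esub> = 1"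
  by (simp_all add: ring_of_type_algebra_def)

lemma complex_field_minus [simp]: "\<ominus>\<^bsub>complex_field\<^esub> a = - a"
proof -
  interpret cring complex_field
    by (rule cring_from_type_algebra)
  show ?thesis
    using minus_equality[of "- a" a] by simp
qed

lemma lin_homD:
  assumes "f \<in> lin_hom A B"
  shows lin_hom_closed: "x \<in> carrier A \<Longrightarrow> f x \<in> carrier B"
    and lin_hom_add: "x \<in> carrier A \<Longrightarrow> y \<in> carrier A \<Longrightarrow> f (x \<oplus>\<^bsub>A\<^esub> y) = f x \<oplus>\<^bsub>B\<^esub> f y"
    and lin_hom_smult: "x \<in> carrier A \<Longrightarrow> f (a \<odot>\<^bsub>A\<^esub> x) = a \<odot>\<^bsub>B\<^esub> f x"
  using assms by (auto simp: lin_hom_def)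

context
  fixes W :: "('g, 'w) rep" (structure)
  assumes W: "module complex_field W"
begin

interpretation module complex_field W
  by (rule W)

lemma rep_smult_add: "x \<in> carrier W \<Longrightarrow> (a + b) \<odot> x = a \<odot> x \<oplus> b \<odot> x"
  using smult_l_distr[of a b x] by simp

lemma rep_smult_mult: "x \<in> carrier W \<Longrightarrow> (a * b) \<odot> x = a \<odot> (b \<odot> x)"
  using smult_assoc1[of a b x] by simp

lemma rep_smult_closed: "x \<in> carrier W \<Longrightarrow> a \<odot> x \<in> carrier W"
  by simp

lemma rep_smult_one: "x \<in> carrier W \<Longrightarrow> 1 \<odot> x = x"
  using smult_one[of x] by simp

lemma rep_smult_minus: "x \<in> carrier W \<Longrightarrow> (- a) \<odot> x = \<ominus> (a \<odot> x)"
  using smult_l_minus[of a x] by simp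

lemma rep_smult_zero: "x \<in> carrier W \<Longrightarrow> 0 \<odot> x = \<zero>"
  using smult_l_null[of x] by simp

lemma rep_add_eq_iff_diff:
  "\<lbrakk>x \<in> carrier W; y \<in> carrier W; z \<in> carrier W\<rbrakk> \<Longrightarrow> x = y \<oplus> z \<longleftrightarrow> x \<ominus> z = y"
  by (metis M.add.inv_closed M.add.inv_solve_right a_minus_def)

lemma lincomb_closed: "B \<subseteq> carrier W \<Longrightarrow> lincomb W c B \<in> carrier W"
  unfolding lincomb_def by (rule M.finsum_closed) auto

lemma lincomb_cong:
  "B \<subseteq> carrier W \<Longrightarrow> (\<And>b. b \<in> B \<Longrightarrow> c b = d b) \<Longrightarrow> lincomb W c B = lincomb W d B"
  unfolding lincomb_def by (rule M.finsum_cong') auto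

lemma lincomb_insert:
  assumes "finite B" "b \<notin> B" "B \<subseteq> carrier W" "b \<in> carrier W"
  shows "lincomb W c (insert b B) = c b \<odot> b \<oplus> lincomb W c B"
  unfolding lincomb_def using assms by (intro M.finsum_insert) auto

lemma lincomb_add:
  assumes "B \<subseteq> carrier W"
  shows "lincomb W (\<lambda>b. c b + d b) B = lincomb W c B \<oplus> lincomb W d B"
  unfolding lincomb_def using assms
  by (subst M.finsum_addf[symmetric]) (auto intro!: M.finsum_cong' rep_smult_add)

lemma lincomb_smult:
  assumes "finite B" "B \<subseteq> carrier W"
  shows "lincomb W (\<lambda>b. a * c b) B = a \<odot> lincomb W c B"
  unfolding lincomb_def using assms
  by (subst finsum_smult_ldistr) (auto intro!: M.finsum_cong' rep_smult_mult)

text \<open>Padding by zero coefficients lets expansions over two different finite sets be compared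
  over their union.\<close>

lemma lincomb_extend:
  assumes "finite B'" "B' \<subseteq> carrier W" "B \<subseteq> B'"
  shows "lincomb W (\<lambda>b. if b \<in> B then c b else 0) B' = lincomb W c B"
  unfolding lincomb_def using assms
  by (intro M.add.finprod_mono_neutral_cong_right) (auto intro: rep_smult_zero)

end

text \<open>\<open>lincomb\<close> sums over a set of vectors, so f must not identify two of them;
  injectivity lets each coefficient follow its vector. The map of interest is the action of a group
  element.\<close>

lemma lincomb_image:
  assumes W: "module complex_field (W :: ('g, 'w) rep)" and Y: "module complex_field (Y :: ('h,
      'x) rep)"
    and f: "f \<in> lin_hom W Y" "inj_on f (carrier W)"
    and B: "finite B" "B \<subseteq> carrier W"
  shows "f (lincomb W c B) = lincomb Y (\<lambda>x. c (inv_into (carrier W) f x)) (f ` B)"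
  using B
proof (induction B rule: finite_induct)
  case empty
  interpret W: module complex_field W
    by (rule W)
  interpret Y: module complex_field Y
    by (rule Y)
  \<comment> \<open>\<open>lin_hom\<close> does not list preservation of zero; it follows from
    homogeneity at the scalar 0.\<close>
  have "f (0 \<odot>\<^bsub>W\<^esub> \<zero>\<^bsub>W\<^esub>) = 0 \<odot>\<^bsub>Y\<^esub> f \<zero>\<^bsub>W\<^esub>"
    using lin_hom_smult[OF f(1)] by blast
  then show ?case
    using rep_smult_zero[OF Y] lin_hom_closed[OF f(1), of "\<zero>\<^bsub>W\<^esub>"] rep_smult_zero[OF W]
    by (simp add: lincomb_def)
next
  case (insert b B)
  have "b \<in> carrier W" "B \<subseteq> carrier W" "f ` B \<subseteq> carrier Y" "f b \<in> carrier Y"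
    using insert.prems lin_hom_closed[OF f(1)] by auto
  moreover have "f b \<notin> f ` B"
    using insert f(2) by (auto simp: inj_on_def)
  ultimately show ?case
    using insert f(2)
    by (simp add: lincomb_insert[OF W] lincomb_insert[OF Y] lin_hom_add[OF f(1)] lin_hom_smult[OF f(1)]
        lincomb_closed[OF W] rep_smult_closed[OF W])
qed

section \<open>Laurent expansions of vector-valued functions\<close>

text \<open>The data that \<open>has_vec_laurent\<close> hides behind existential quantifiers, with
  the finite set as a parameter, so that two functions can be expanded over the same set.\<close>

definition laurent_coords ::
    "('g, 'w) rep \<Rightarrow> 'w set \<Rightarrow> (complex \<Rightarrow> 'w) \<Rightarrow> complex \<Rightarrow> (int \<Rightarrow> 'w)
      \<Rightarrow> ('w \<Rightarrow> complex \<Rightarrow> complex) \<Rightarrow> ('w \<Rightarrow> complex fls) \<Rightarrow> bool" where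
  "laurent_coords W B f z a c F \<longleftrightarrow>
     (\<forall>b\<in>B. (\<lambda>t. c b (z + t)) has_laurent_expansion F b) \<and>
     (\<forall>\<^sub>F s in at z. f s = lincomb W (\<lambda>b. c b s) B) \<and>
     (\<forall>k. a k = lincomb W (\<lambda>b. fls_nth (F b) k) B)"

lemma has_vec_laurent_iff:
  "has_vec_laurent W f z a \<longleftrightarrow> (\<exists>B. finite B \<and> B \<subseteq> carrier W \<and> (\<exists>c F. laurent_coords W B f z a c F))"
  unfolding has_vec_laurent_def laurent_coords_def by blast

context
  fixes W :: "('g, 'w) rep" (structure)
  assumes W: "module complex_field W"
begin

interpretation module complex_field W
  by (rule W)

text \<open>
  No linear independence of \<open>B\<close> is assumed: in the induction, a new vector that depends on the others is
  substituted away, and the coefficient of an independent one vanishes near \<open>z\<close>.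
\<close>

lemma lincomb_laurent_zero:
  assumes "finite B" "B \<subseteq> carrier W"
    and "\<And>b. b \<in> B \<Longrightarrow> (\<lambda>t. c b (z + t)) has_laurent_expansion F b"
    and "\<forall>\<^sub>F s in at z. lincomb W (\<lambda>b. c b s) B = \<zero>"
  shows "lincomb W (\<lambda>b. fls_nth (F b) k) B = \<zero>"
  using assms
proof (induction B arbitrary: c F rule: finite_induct)
  case empty
  then show ?case
    by (simp add: lincomb_def)
next
  case (insert b0 B)
  have B: "B \<subseteq> carrier W" and b0: "b0 \<in> carrier W"
    using insert.prems by auto
  have ev: "\<forall>\<^sub>F s in at z. c b0 s \<odot> b0 \<oplus> lincomb W (\<lambda>b. c b s) B = \<zero>"
    using insert.prems(3) by (simp add: lincomb_insert[OF W] insert.hyps B b0)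
  have sum: "x \<odot> b0 \<oplus> lincomb W d B = lincomb W (\<lambda>b. d b + x * \<mu> b) B"
    if "b0 = lincomb W \<mu> B" for x d \<mu>
    using that insert.hyps B b0
    by (simp add: lincomb_add[OF W] lincomb_smult[OF W] lincomb_closed[OF W] M.a_comm)
  show ?case
  proof (cases "\<exists>\<mu>. b0 = lincomb W \<mu> B")
    case True
    then obtain \<mu> where \<mu>: "b0 = lincomb W \<mu> B"
      by blast
    have "lincomb W (\<lambda>b. fls_nth (F b + F b0 * fls_const (\<mu> b)) k) B = \<zero>"
    proof (rule insert.IH[OF B])
      show "(\<lambda>t. c b (z + t) + c b0 (z + t) * \<mu> b) has_laurent_expansion F b + F b0 * fls_const (\<mu> b)"
        if "b \<in> B" for b
        using that by (intro laurent_expansion_intros insert.prems(2)) auto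
      show "\<forall>\<^sub>F s in at z. lincomb W (\<lambda>b. c b s + c b0 s * \<mu> b) B = \<zero>"
        using ev by eventually_elim (simp add: sum[OF \<mu>])
    qed
    then show ?thesis
      by (simp add: lincomb_insert[OF W] insert.hyps B b0 sum[OF \<mu>])
  next
    case False
    \<comment> \<open>Otherwise division by \<open>c b0 s\<close> would express \<open>b0\<close>
      through B.\<close>
    have zero: "c b0 s = 0" if "c b0 s \<odot> b0 \<oplus> lincomb W (\<lambda>b. c b s) B = \<zero>" for s
    proof (rule ccontr)
      assume nz: "c b0 s \<noteq> 0"
      have "b0 = inverse (c b0 s) \<odot> (c b0 s \<odot> b0)"
        using nz b0 by (simp add: rep_smult_mult[OF W, symmetric] rep_smult_one[OF W])
      also have "c b0 s \<odot> b0 = \<ominus> lincomb W (\<lambda>b. c b s) B"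
        using that b0 B M.minus_equality[of "c b0 s \<odot> b0" "lincomb W (\<lambda>b. c b s) B"]
        by (simp add: lincomb_closed[OF W])
      also have "\<dots> = lincomb W (\<lambda>b. - 1 * c b s) B"
        using insert.hyps B
        by (subst lincomb_smult[OF W]) (auto simp: rep_smult_minus[OF W] rep_smult_one[OF W]
            lincomb_closed[OF W])
      also have "inverse (c b0 s) \<odot> \<dots> = lincomb W (\<lambda>b. inverse (c b0 s) * (- 1 * c b s)) B"
        using insert.hyps B by (subst lincomb_smult[OF W]) auto
      finally show False
        using False by blast
    qed
    have c0: "\<forall>\<^sub>F s in at z. c b0 s = 0"
      using ev by eventually_elim (rule zero)
    have "(\<lambda>t. c b0 (z + t)) has_laurent_expansion F b0"
      using insert.prems by simp
    then have "(\<lambda>t. 0) has_laurent_expansion F b0"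
      using has_laurent_expansion_cong'[OF c0 refl refl] by blast
    then have F0: "F b0 = 0"
      by (rule zero_has_laurent_expansion_imp_eq_0)
    have "lincomb W (\<lambda>b. fls_nth (F b) k) B = \<zero>"
    proof (rule insert.IH[OF B])
      show "\<forall>\<^sub>F s in at z. lincomb W (\<lambda>b. c b s) B = \<zero>"
        using ev c0 by eventually_elim (simp add: rep_smult_zero[OF W] b0 B lincomb_closed[OF W])
    qed (use insert.prems in auto)
    then show ?thesis
      by (simp add: lincomb_insert[OF W] insert.hyps B b0 F0 rep_smult_zero[OF W])
  qed
qed

text \<open>New vectors receive the zero function and the zero series. All larger finite sets are
  allowed because the one eventually used is the union with the set of a second function.\<close>

lemma has_vec_laurent_extend:
  assumes "has_vec_laurent W f z a"
  shows "\<exists>B. finite B \<and> B \<subseteq> carrier W \<and> (\<forall>B'. finite B' \<and> B' \<subseteq> carrier W \<and> B \<subseteq> B' \<longrightarrow>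
    (\<exists>c F. laurent_coords W B' f z a c F))"
proof -
  from assms obtain B c F where B: "finite B" "B \<subseteq> carrier W" and c: "laurent_coords W B f z a c F"
    by (auto simp: has_vec_laurent_iff)
  show ?thesis
  proof (intro exI[of _ B] conjI allI impI B)
    fix B' assume "finite B' \<and> B' \<subseteq> carrier W \<and> B \<subseteq> B'"
    then have B': "finite B'" "B' \<subseteq> carrier W" "B \<subseteq> B'"
      by auto
    define c' where "c' = (\<lambda>b s. if b \<in> B then c b s else 0)"
    define F' where "F' = (\<lambda>b. if b \<in> B then F b else 0)"
    have "\<forall>b\<in>B'. (\<lambda>t. c' b (z + t)) has_laurent_expansion F' b"
      using c by (auto simp: c'_def F'_def laurent_coords_def)
    moreover have "\<forall>\<^sub>F s in at z. f s = lincomb W (\<lambda>b. c' b s) B'"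
      using c unfolding c'_def lincomb_extend[OF W B'] laurent_coords_def by blast
    moreover have "fls_nth (F' b) k = (if b \<in> B then fls_nth (F b) k else 0)" for b k
      by (simp add: F'_def)
    then have "\<forall>k. a k = lincomb W (\<lambda>b. fls_nth (F' b) k) B'"
      using c lincomb_extend[OF W B'] by (simp add: laurent_coords_def)
    ultimately show "\<exists>c F. laurent_coords W B' f z a c F"
      unfolding laurent_coords_def by blast
  qed
qed

lemma has_vec_laurent_common:
  assumes "has_vec_laurent W f z a" "has_vec_laurent W g z a'"
  obtains B c F c' F' where "finite B" "B \<subseteq> carrier W"
    "laurent_coords W B f z a c F" "laurent_coords W B g z a' c' F'"
proof -
  obtain B1 where B1: "finite B1" "B1 \<subseteq> carrier W"
    "\<forall>B'. finite B' \<and> B' \<subseteq> carrier W \<and> B1 \<subseteq> B' \<longrightarrow> (\<exists>c F. laurent_coords W B' f z a c F)"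
    using has_vec_laurent_extend[OF assms(1)] by blast
  obtain B2 where B2: "finite B2" "B2 \<subseteq> carrier W"
    "\<forall>B'. finite B' \<and> B' \<subseteq> carrier W \<and> B2 \<subseteq> B' \<longrightarrow> (\<exists>c F. laurent_coords W B' g z a' c F)"
    using has_vec_laurent_extend[OF assms(2)] by blast
  have B: "finite (B1 \<union> B2)" "B1 \<union> B2 \<subseteq> carrier W"
    using B1(1,2) B2(1,2) by auto
  obtain c F where c: "laurent_coords W (B1 \<union> B2) f z a c F"
    using B1(3) B by blast
  obtain c' F' where c': "laurent_coords W (B1 \<union> B2) g z a' c' F'"
    using B2(3) B by blast
  show thesis
    using that[OF B c c'] .
qed

lemma has_vec_laurent_cong:
  assumes "has_vec_laurent W f z a" "\<forall>\<^sub>F s in at z. f s = g s"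
  shows "has_vec_laurent W g z a"
proof -
  from assms(1) obtain B c F where *: "finite B" "B \<subseteq> carrier W"
    "\<forall>b\<in>B. (\<lambda>t. c b (z + t)) has_laurent_expansion F b"
    "\<forall>\<^sub>F s in at z. f s = lincomb W (\<lambda>b. c b s) B"
    "\<forall>k. a k = lincomb W (\<lambda>b. fls_nth (F b) k) B"
    unfolding has_vec_laurent_def by blast
  have "\<forall>\<^sub>F s in at z. g s = lincomb W (\<lambda>b. c b s) B"
    using *(4) assms(2) by eventually_elim simp
  with * show ?thesis
    unfolding has_vec_laurent_def by blast
qed

text \<open>This gives the definite description in \<open>laurent_coeff\<close> its meaning. Over a
  common finite set the difference of two expansions of f is an expansion of the zero function, and
  \<open>lincomb_laurent_zero\<close> applies in each degree.\<close>

lemma has_vec_laurent_unique: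
  assumes "has_vec_laurent W f z a" "has_vec_laurent W f z a'"
  shows "a = a'"
proof
  fix k
  obtain B c F c' F' where B: "finite B" "B \<subseteq> carrier W"
    and coords: "laurent_coords W B f z a c F" "laurent_coords W B f z a' c' F'"
    using has_vec_laurent_common[OF assms] .
  note c = coords(1)[unfolded laurent_coords_def, THEN conjunct1, THEN bspec]
    coords(1)[unfolded laurent_coords_def, THEN conjunct2, THEN conjunct1]
    coords(1)[unfolded laurent_coords_def, THEN conjunct2, THEN conjunct2, THEN spec]
  note c' = coords(2)[unfolded laurent_coords_def, THEN conjunct1, THEN bspec]
    coords(2)[unfolded laurent_coords_def, THEN conjunct2, THEN conjunct1]
    coords(2)[unfolded laurent_coords_def, THEN conjunct2, THEN conjunct2, THEN spec]
  \<comment> \<open>Subtraction is spelled as adding -1 times the second family, so that the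
    difference is again a single \<open>lincomb\<close>.\<close>
  have diff: "lincomb W (\<lambda>b. x b + - 1 * y b) B = \<zero> \<longleftrightarrow> lincomb W x B = lincomb W y B" for x y
    using B rep_add_eq_iff_diff[OF W, of "lincomb W x B" \<zero> "lincomb W y B"]
    by (simp only: lincomb_add[OF W] lincomb_smult[OF W] rep_smult_minus[OF W] rep_smult_one[OF W]
        lincomb_closed[OF W] M.zero_closed M.l_zero flip: a_minus_def)
  have "lincomb W (\<lambda>b. fls_nth (F b + fls_const (- 1) * F' b) k) B = \<zero>"
  proof (rule lincomb_laurent_zero[OF B])
    show "(\<lambda>t. c b (z + t) + - 1 * c' b (z + t)) has_laurent_expansion F b + fls_const (- 1) * F' b"
      if "b \<in> B" for b
      using that by (intro laurent_expansion_intros c(1) c'(1)) auto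
    show "\<forall>\<^sub>F s in at z. lincomb W (\<lambda>b. c b s + - 1 * c' b s) B = \<zero>"
      using c(2) c'(2) by eventually_elim (simp only: diff)
  qed
  then show "a k = a' k"
    using diff[of "\<lambda>b. fls_nth (F b) k" "\<lambda>b. fls_nth (F' b) k"] by (simp add: c(3) c'(3))
qed

lemma laurent_coeff_eq:
  assumes "has_vec_laurent W f z a"
  shows "laurent_coeff W f z = a"
  unfolding laurent_coeff_def using assms has_vec_laurent_unique by blast

lemma has_vec_laurent_closed: "has_vec_laurent W f z a \<Longrightarrow> a k \<in> carrier W"
  by (auto simp: has_vec_laurent_def lincomb_closed[OF W])

lemma has_vec_laurent_add:
  assumes "has_vec_laurent W f z a" "has_vec_laurent W g z a'"
  shows "has_vec_laurent W (\<lambda>s. f s \<oplus> g s) z (\<lambda>k. a k \<oplus> a' k)"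
proof -
  obtain B c F c' F' where B: "finite B" "B \<subseteq> carrier W"
    and coords: "laurent_coords W B f z a c F" "laurent_coords W B g z a' c' F'"
    using has_vec_laurent_common[OF assms] .
  note c = coords(1)[unfolded laurent_coords_def, THEN conjunct1, THEN bspec]
    coords(1)[unfolded laurent_coords_def, THEN conjunct2, THEN conjunct1]
    coords(1)[unfolded laurent_coords_def, THEN conjunct2, THEN conjunct2, THEN spec]
  note c' = coords(2)[unfolded laurent_coords_def, THEN conjunct1, THEN bspec]
    coords(2)[unfolded laurent_coords_def, THEN conjunct2, THEN conjunct1]
    coords(2)[unfolded laurent_coords_def, THEN conjunct2, THEN conjunct2, THEN spec]
  have "\<forall>b\<in>B. (\<lambda>t. c b (z + t) + c' b (z + t)) has_laurent_expansion F b + F' b"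
    using c(1) c'(1) by (auto intro: laurent_expansion_intros)
  moreover have "\<forall>\<^sub>F s in at z. f s \<oplus> g s = lincomb W (\<lambda>b. c b s + c' b s) B"
    using c(2) c'(2) by eventually_elim (simp add: lincomb_add[OF W] B)
  moreover have "\<forall>k. a k \<oplus> a' k = lincomb W (\<lambda>b. fls_nth (F b + F' b) k) B"
    by (simp add: c(3) c'(3) lincomb_add[OF W] B)
  ultimately show ?thesis
    unfolding has_vec_laurent_def using B
    by (intro exI[of _ B] exI[of _ "\<lambda>b s. c b s + c' b s"] exI[of _ "\<lambda>b. F b + F' b"]) auto
qed

text \<open>The new coefficients are read off the product series \<open>H * F b\<close>. They are
  made explicit only for a power of the variable, where they are shifted, and for a constant, where
  they are scaled.\<close>

lemma has_vec_laurent_mult: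
  assumes "has_vec_laurent W f z a" and h: "(\<lambda>t. h (z + t)) has_laurent_expansion H"
  shows "\<exists>a'. has_vec_laurent W (\<lambda>s. h s \<odot> f s) z a' \<and>
    (\<forall>n. H = fls_X_intpow n \<longrightarrow> a' = (\<lambda>k. a (k - n))) \<and> (\<forall>\<mu>. H = fls_const \<mu> \<longrightarrow> a' = (\<lambda>k. \<mu> \<odot> a k))"
proof -
  from assms(1) obtain B c F where B: "finite B" "B \<subseteq> carrier W"
    and c: "\<forall>b\<in>B. (\<lambda>t. c b (z + t)) has_laurent_expansion F b"
    and f: "\<forall>\<^sub>F s in at z. f s = lincomb W (\<lambda>b. c b s) B"
    and a: "\<And>k. a k = lincomb W (\<lambda>b. fls_nth (F b) k) B"
    unfolding has_vec_laurent_def by blast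
  have "\<forall>b\<in>B. (\<lambda>t. h (z + t) * c b (z + t)) has_laurent_expansion H * F b"
    using c h by (auto intro: laurent_expansion_intros)
  moreover have "\<forall>\<^sub>F s in at z. h s \<odot> f s = lincomb W (\<lambda>b. h s * c b s) B"
    using f by eventually_elim (simp add: lincomb_smult[OF W] B)
  ultimately have "has_vec_laurent W (\<lambda>s. h s \<odot> f s) z (\<lambda>k. lincomb W (\<lambda>b. fls_nth (H * F b) k) B)"
    unfolding has_vec_laurent_def using B
    by (intro exI[of _ B] exI[of _ "\<lambda>b s. h s * c b s"] exI[of _ "\<lambda>b. H * F b"]) auto
  then show ?thesis
    by (intro exI conjI) (auto simp: a lincomb_smult[OF W] B fls_X_intpow_times_conv_shift)
qed

text \<open>Moves a residue into the constant term, where it can be compared with the constant terms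
  of \<xi>.\<close>

lemma has_vec_laurent_shift:
  assumes "has_vec_laurent W f z a"
  shows "has_vec_laurent W (\<lambda>s. (s - z) \<odot> f s) z (\<lambda>k. a (k - 1))"
proof -
  have "(\<lambda>t. (z + t) - z) has_laurent_expansion fls_X_intpow 1"
    using has_laurent_expansion_fps_X_power_int[of 1] by simp
  from has_vec_laurent_mult[OF assms this] show ?thesis
    by auto
qed

lemma has_vec_laurent_smult:
  assumes "has_vec_laurent W f z a"
  shows "has_vec_laurent W (\<lambda>s. \<mu> \<odot> f s) z (\<lambda>k. \<mu> \<odot> a k)"
  using has_vec_laurent_mult[OF assms has_laurent_expansion_const[of \<mu>]] by auto

text \<open>Holomorphy prescribes f on a full neighbourhood, z included (\<open>nhds\<close>, not
  \<open>at\<close>). This ties the constant term of the Taylor coefficients to the value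
  \<open>f z\<close>.\<close>

lemma vec_holomorphic_at_has_vec_laurent:
  assumes "vec_holomorphic_at W f z"
  obtains a where "has_vec_laurent W f z a" "a 0 = f z"
proof -
  from assms obtain B c where B: "finite B" "B \<subseteq> carrier W"
    and c: "\<forall>b\<in>B. c b analytic_on {z}"
    and f: "\<forall>\<^sub>F s in nhds z. f s = lincomb W (\<lambda>b. c b s) B"
    unfolding vec_holomorphic_at_def by blast
  define P where "P = (\<lambda>b. fps_expansion (c b) z)"
  have P: "(\<lambda>t. c b (z + t)) has_fps_expansion P b" if "b \<in> B" for b
    unfolding P_def using c that by (intro analytic_at_imp_has_fps_expansion) auto
  have "has_vec_laurent W f z (\<lambda>k. lincomb W (\<lambda>b. fls_nth (fps_to_fls (P b)) k) B)"
    unfolding has_vec_laurent_def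
  proof (intro exI[of _ B] exI[of _ c] exI[of _ "\<lambda>b. fps_to_fls (P b)"] conjI ballI allI refl)
    show "\<forall>\<^sub>F s in at z. f s = lincomb W (\<lambda>b. c b s) B"
      using f by (rule filter_leD[OF at_within_le_nhds])
  qed (use B P has_laurent_expansion_fps in auto)
  moreover have "lincomb W (\<lambda>b. fls_nth (fps_to_fls (P b)) 0) B = lincomb W (\<lambda>b. c b z) B"
    using B(2)
  proof (rule lincomb_cong[OF W])
    show "fls_nth (fps_to_fls (P b)) 0 = c b z" if "b \<in> B" for b
      using has_fps_expansion_imp_0_eq_fps_nth_0[OF P[OF that]] by simp
  qed
  moreover have "f z = lincomb W (\<lambda>b. c b z) B"
    using f by (rule eventually_nhds_x_imp_x)
  ultimately show thesis
    using that by simp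
qed

text \<open>Only finitely many coefficient functions occur, so their poles are jointly isolated at
  z. Off its poles a nicely meromorphic function is analytic, with no removable singularities left,
  which is what holomorphy at the nearby points requires.\<close>

lemma vec_meromorphic_onD:
  assumes "vec_meromorphic_on W E f D" "E \<subseteq> carrier W" "open D" "z \<in> D"
  shows "\<exists>a. has_vec_laurent W f z a" and "\<forall>\<^sub>F s in at z. vec_holomorphic_at W f s"
proof -
  from assms(1) obtain B c where "fin_basis W E B"
    and c: "\<And>b. b \<in> B \<Longrightarrow> c b nicely_meromorphic_on D"
    and f: "\<forall>s\<in>D. (\<exists>b\<in>B. is_pole (c b) s) \<or> f s = lincomb W (\<lambda>b. c b s) B"
    unfolding vec_meromorphic_on_def by blast
  then have B: "finite B" "B \<subseteq> carrier W"
    using assms(2) by (auto simp: fin_basis_def)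
  have mer: "c b meromorphic_on D" if "b \<in> B" for b
    using c[OF that] by (simp add: nicely_meromorphic_on_def)
  have "\<forall>b\<in>B. \<forall>\<^sub>F s in at z. \<not> is_pole (c b) s"
  proof
    fix b assume "b \<in> B"
    then show "\<forall>\<^sub>F s in at z. \<not> is_pole (c b) s"
      using meromorphic_onE[OF mer] assms(4) eventually_not_pole by blast
  qed
  then have "\<forall>\<^sub>F s in at z. \<forall>b\<in>B. \<not> is_pole (c b) s"
    using B(1) by (simp add: eventually_ball_finite_distrib)
  moreover have "\<forall>\<^sub>F s in at z. s \<in> D"
    using assms(3,4) by (rule eventually_at_in_open')
  ultimately have ev: "\<forall>\<^sub>F s in at z. s \<in> D \<and> (\<forall>b\<in>B. \<not> is_pole (c b) s)"
    by eventually_elim simp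
  have "\<forall>b\<in>B. \<exists>H. (\<lambda>t. c b (z + t)) has_laurent_expansion H"
    using mer assms(4) by (auto simp: meromorphic_on_def)
  from bchoice[OF this] obtain H where H: "\<forall>b\<in>B. (\<lambda>t. c b (z + t)) has_laurent_expansion H b"
    by blast
  have "\<forall>\<^sub>F s in at z. f s = lincomb W (\<lambda>b. c b s) B"
    using ev by eventually_elim (use f in blast)
  then have "laurent_coords W B f z (\<lambda>k. lincomb W (\<lambda>b. fls_nth (H b) k) B) c H"
    using H by (simp add: laurent_coords_def)
  then show "\<exists>a. has_vec_laurent W f z a"
    unfolding has_vec_laurent_iff using B by blast
  from ev obtain S where S: "open S" "z \<in> S"
    "\<And>s. s \<in> S \<Longrightarrow> s \<noteq> z \<Longrightarrow> s \<in> D \<and> (\<forall>b\<in>B. \<not> is_pole (c b) s)"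
    unfolding eventually_at_topological by auto
  have "vec_holomorphic_at W f s" if s: "s \<in> S - {z}" for s
    unfolding vec_holomorphic_at_def
  proof (intro exI[of _ B] exI[of _ c] conjI ballI B)
    show "c b analytic_on {s}" if "b \<in> B" for b
      using nicely_meromorphic_on_imp_analytic_at[OF c[OF that]] S(3) s that by blast
    \<comment> \<open>Removing z leaves an open set, so the coordinate formula holds on a full
      neighbourhood of s.\<close>
    have "\<forall>\<^sub>F s in nhds s. s \<in> S - {z}"
      using s S(1) by (intro eventually_nhds_in_open) auto
    then show "\<forall>\<^sub>F s in nhds s. f s = lincomb W (\<lambda>b. c b s) B"
      by eventually_elim (use S(3) f in blast)
  qed
  then show "\<forall>\<^sub>F s in at z. vec_holomorphic_at W f s"
    unfolding eventually_at_topological using S(1,2) by blast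
qed

end

text \<open>The coordinate functions are carried along the bijection of B with its image, so the
  series themselves do not change. It is applied to the action of a group element on W.\<close>

lemma has_vec_laurent_image:
  assumes W: "module complex_field (W :: ('g, 'w) rep)" and Y: "module complex_field (Y :: ('h,
      'x) rep)"
    and \<phi>: "\<phi> \<in> lin_hom W Y" "inj_on \<phi> (carrier W)"
    and f: "has_vec_laurent W f z a"
  shows "has_vec_laurent Y (\<lambda>s. \<phi> (f s)) z (\<lambda>k. \<phi> (a k))"
proof -
  from f obtain B c F where B: "finite B" "B \<subseteq> carrier W"
    and c: "\<forall>b\<in>B. (\<lambda>t. c b (z + t)) has_laurent_expansion F b"
    and f: "\<forall>\<^sub>F s in at z. f s = lincomb W (\<lambda>b. c b s) B"
    and a: "\<forall>k. a k = lincomb W (\<lambda>b. fls_nth (F b) k) B"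
    unfolding has_vec_laurent_def by blast
  let ?i = "inv_into (carrier W) \<phi>"
  note im = lincomb_image[OF W Y \<phi> B]
  show ?thesis
    unfolding has_vec_laurent_def
  proof (intro exI[of _ "\<phi> ` B"] exI[of _ "\<lambda>x. c (?i x)"] exI[of _ "\<lambda>x. F (?i x)"] conjI ballI allI)
    show "\<forall>\<^sub>F s in at z. \<phi> (f s) = lincomb Y (\<lambda>x. c (?i x) s) (\<phi> ` B)"
      using f by eventually_elim (simp add: im)
    show "(\<lambda>t. c (?i x) (z + t)) has_laurent_expansion F (?i x)" if "x \<in> \<phi> ` B" for x
      using that c B(2) \<phi>(2) by (auto simp: inv_into_f_f subset_iff)
  qed (use B a lin_hom_closed[OF \<phi>(1)] im in auto)
qed

section \<open>Representations and quotients\<close>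

lemma
  assumes "representation G V"
  shows rep_module: "module complex_field V"
    and rep_act_lin: "g \<in> carrier G \<Longrightarrow> act V g \<in> lin_hom V V"
    and rep_act_one: "v \<in> carrier V \<Longrightarrow> act V \<one>\<^bsub>G\<^esub> v = v"
    and rep_act_mult: "g \<in> carrier G \<Longrightarrow> h \<in> carrier G \<Longrightarrow> v \<in> carrier V \<Longrightarrow>
      act V (g \<otimes>\<^bsub>G\<^esub> h) v = act V g (act V h v)"
  using assms by (auto simp: representation_def)

lemma rep_act_closed:
  "representation G V \<Longrightarrow> g \<in> carrier G \<Longrightarrow> v \<in> carrier V \<Longrightarrow> act V g v \<in> carrier V"
  by (rule lin_hom_closed[OF rep_act_lin])

lemma
  assumes "group G" "representation G V" "g \<in> carrier G" "v \<in> carrier V"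
  shows rep_act_inv_act: "act V (inv\<^bsub>G\<^esub> g) (act V g v) = v"
    and rep_act_act_inv: "act V g (act V (inv\<^bsub>G\<^esub> g) v) = v"
  using assms rep_act_mult[OF assms(2), of "inv\<^bsub>G\<^esub> g" g v] rep_act_mult[OF assms(2), of g "inv\<^bsub>G\<^esub> g" v]
  by (simp_all add: group.l_inv group.r_inv rep_act_one group.inv_closed)

lemma lin_hom_diff_arg:
  assumes f: "f \<in> lin_hom A B" and A: "module complex_field (A :: ('g, 'a) rep)"
    and B: "module complex_field (B :: ('h, 'b) rep)"
    and "x \<in> carrier A" "y \<in> carrier A"
  shows "f (x \<ominus>\<^bsub>A\<^esub> y) = f x \<ominus>\<^bsub>B\<^esub> f y"
proof -
  interpret A: module complex_field A by (rule A)
  interpret B: module complex_field B by (rule B)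
  have "f (\<ominus>\<^bsub>A\<^esub> y) = \<ominus>\<^bsub>B\<^esub> f y"
    using lin_hom_smult[OF f, of y "- 1"] lin_hom_closed[OF f] assms(5)
    by (simp add: rep_smult_minus[OF A] rep_smult_minus[OF B] rep_smult_one[OF A] rep_smult_one[OF B])
  then show ?thesis
    using assms by (simp add: a_minus_def lin_hom_add[OF f])
qed

lemma module_diff_sums:
  assumes B: "module complex_field (B :: ('h, 'b) rep)"
    and "x \<in> carrier B" "y \<in> carrier B" "z \<in> carrier B" "w \<in> carrier B"
  shows "(x \<oplus>\<^bsub>B\<^esub> y) \<ominus>\<^bsub>B\<^esub> (z \<oplus>\<^bsub>B\<^esub> w) = (x \<ominus>\<^bsub>B\<^esub> z) \<oplus>\<^bsub>B\<^esub> (y \<ominus>\<^bsub>B\<^esub> w)"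
proof -
  interpret B: module complex_field B by (rule B)
  show ?thesis
    using assms by (simp add: a_minus_def B.minus_add B.M.a_ac)
qed

text \<open>The algebra behind both cohomology relations: if two cocycles differ from a common x by
  the coboundaries z and y, then they differ from each other by \<open>y - z\<close>.\<close>

lemma module_add_via:
  assumes B: "module complex_field (B :: ('h, 'b) rep)"
    and "x \<in> carrier B" "y \<in> carrier B" "z \<in> carrier B"
  shows "x \<oplus>\<^bsub>B\<^esub> y = (x \<oplus>\<^bsub>B\<^esub> z) \<oplus>\<^bsub>B\<^esub> (y \<ominus>\<^bsub>B\<^esub> z)"
proof -
  interpret B: module complex_field B by (rule B)
  show ?thesis
    using assms by (simp add: a_minus_def B.M.a_assoc B.M.a_lcomm[of z y] B.M.r_neg)
qed

lemma module_smult_diff: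
  assumes B: "module complex_field (B :: ('h, 'b) rep)" and "x \<in> carrier B" "y \<in> carrier B"
  shows "a \<odot>\<^bsub>B\<^esub> (x \<ominus>\<^bsub>B\<^esub> y) = a \<odot>\<^bsub>B\<^esub> x \<ominus>\<^bsub>B\<^esub> a \<odot>\<^bsub>B\<^esub> y"
proof -
  interpret B: module complex_field B by (rule B)
  show ?thesis
    using assms B.smult_r_minus[of a y] by (simp add: a_minus_def B.smult_r_distr)
qed

lemma lin_hom_diff:
  assumes B: "module complex_field (B :: ('h, 'b) rep)" and "f \<in> lin_hom A B" "f' \<in> lin_hom A B"
  shows "(\<lambda>x. f x \<ominus>\<^bsub>B\<^esub> f' x) \<in> lin_hom A B"
proof -
  interpret B: module complex_field B by (rule B)
  show ?thesis
    using assms(2,3) module_diff_sums[OF B] module_smult_diff[OF B]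
    by (auto simp: lin_hom_def Pi_def)
qed

lemma lin_hom_zero:
  assumes B: "module complex_field (B :: ('h, 'b) rep)"
  shows "(\<lambda>x. \<zero>\<^bsub>B\<^esub>) \<in> lin_hom A B"
proof -
  interpret B: module complex_field B by (rule B)
  show ?thesis
    using B.smult_r_null by (auto simp: lin_hom_def)
qed

section \<open>Cosets and the quotient representation\<close>

context
  fixes G :: "('g, 'm) monoid_scheme" and V :: "('g, 'v) rep" and U :: "'v set"
  assumes G: "group G" and V: "representation G V" and U: "is_subrep G V U"
begin

interpretation G: group G
  by (rule G)

interpretation V: module complex_field V
  by (rule rep_module[OF V])

lemma subrep_subset: "U \<subseteq> carrier V"
  using V.submoduleE(1) U by (auto simp: is_subrep_def)

interpretation U: abelian_subgroup U V
proof (rule abelian_subgroupI3)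
  show "additive_subgroup U V"
    using U by (simp add: is_subrep_def submodule_def additive_subgroup_def)
qed (rule V.M.abelian_group_axioms)

lemma subrep_smult_closed: "u \<in> U \<Longrightarrow> a \<odot>\<^bsub>V\<^esub> u \<in> U"
  using V.submoduleE(4)[of U a u] U by (simp add: is_subrep_def)

lemma subrep_act_closed: "g \<in> carrier G \<Longrightarrow> u \<in> U \<Longrightarrow> act V g u \<in> U"
  using U by (simp add: is_subrep_def)

lemma subrep_add_closed: "u \<in> U \<Longrightarrow> u' \<in> U \<Longrightarrow> u \<oplus>\<^bsub>V\<^esub> u' \<in> U"
  by (rule U.a_closed)

lemma coset_eqD:
  assumes "v \<in> carrier V" "w \<in> carrier V" "U +>\<^bsub>V\<^esub> v = U +>\<^bsub>V\<^esub> w"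
  shows "\<exists>u\<in>U. v = u \<oplus>\<^bsub>V\<^esub> w"
proof -
  have "v \<in> U +>\<^bsub>V\<^esub> w"
    using U.a_rcos_self[OF assms(1)] assms(3) by simp
  then show ?thesis
    by (auto simp: a_r_coset_def')
qed

lemma coset_add_subrep: "u \<in> U \<Longrightarrow> v \<in> carrier V \<Longrightarrow> U +>\<^bsub>V\<^esub> (u \<oplus>\<^bsub>V\<^esub> v) = U +>\<^bsub>V\<^esub> v"
  using subrep_subset by (simp add: V.M.a_coset_add_assoc[symmetric] U.a_rcos_const subset_iff)

text \<open>Scalar multiplication and action in \<open>quot_rep\<close> are unions over all
  representatives of a coset. A linear map preserving U sends all of them into one coset, so each
  union collapses to the coset of the image of a single representative.\<close>

lemma coset_Union:
  assumes v: "v \<in> carrier V" and h: "h \<in> lin_hom V V" "h ` U \<subseteq> U"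
  shows "(\<Union>x\<in>U +>\<^bsub>V\<^esub> v. U +>\<^bsub>V\<^esub> h x) = U +>\<^bsub>V\<^esub> h v"
proof -
  have "U +>\<^bsub>V\<^esub> h x = U +>\<^bsub>V\<^esub> h v" if "x \<in> U +>\<^bsub>V\<^esub> v" for x
  proof -
    from that obtain u where u: "u \<in> U" "x = u \<oplus>\<^bsub>V\<^esub> v"
      by (auto simp: a_r_coset_def')
    have "u \<in> carrier V"
      using u subrep_subset by auto
    then have "h x = h u \<oplus>\<^bsub>V\<^esub> h v"
      using u v lin_hom_add[OF h(1)] by simp
    then show ?thesis
      using u v h lin_hom_closed[OF h(1)] by (auto intro!: coset_add_subrep)
  qed
  moreover have "v \<in> U +>\<^bsub>V\<^esub> v"
    using v by (rule U.a_rcos_self)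
  ultimately show ?thesis
    by blast
qed

lemma quot_carrier: "carrier (quot_rep V U) = (\<lambda>v. U +>\<^bsub>V\<^esub> v) ` carrier V"
  by (auto simp: quot_rep_def A_RCOSETS_def' a_r_coset_def)

text \<open>Zero is put in the form of a coset of a vector, like the results of the other
  operations, so that each module axiom reduces to the one in V. \<open>a_coset_add_zero\<close> is
  disabled below because it would undo this form.\<close>

lemma quot_zero: "\<zero>\<^bsub>quot_rep V U\<^esub> = U +>\<^bsub>V\<^esub> \<zero>\<^bsub>V\<^esub>"
  using subrep_subset by (simp add: quot_rep_def)

lemma quot_add:
  "v \<in> carrier V \<Longrightarrow> w \<in> carrier V \<Longrightarrow>
    (U +>\<^bsub>V\<^esub> v) \<oplus>\<^bsub>quot_rep V U\<^esub> (U +>\<^bsub>V\<^esub> w) = U +>\<^bsub>V\<^esub> (v \<oplus>\<^bsub>V\<^esub> w)"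
  by (simp add: quot_rep_def U.a_rcos_sum)

lemma quot_smult:
  "v \<in> carrier V \<Longrightarrow> a \<odot>\<^bsub>quot_rep V U\<^esub> (U +>\<^bsub>V\<^esub> v) = U +>\<^bsub>V\<^esub> (a \<odot>\<^bsub>V\<^esub> v)"
proof -
  assume v: "v \<in> carrier V"
  have "(\<lambda>x. a \<odot>\<^bsub>V\<^esub> x) \<in> lin_hom V V"
    by (auto simp: lin_hom_def V.smult_r_distr rep_smult_mult[OF rep_module[OF V], symmetric]
        mult.commute)
  then have "(\<Union>x\<in>U +>\<^bsub>V\<^esub> v. U +>\<^bsub>V\<^esub> (a \<odot>\<^bsub>V\<^esub> x)) = U +>\<^bsub>V\<^esub> (a \<odot>\<^bsub>V\<^esub> v)"
    using v subrep_smult_closed by (intro coset_Union) auto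
  then show ?thesis
    by (simp add: quot_rep_def)
qed

lemma quot_act:
  assumes "g \<in> carrier G" "v \<in> carrier V"
  shows "act (quot_rep V U) g (U +>\<^bsub>V\<^esub> v) = U +>\<^bsub>V\<^esub> act V g v"
  using coset_Union[OF assms(2) rep_act_lin[OF V assms(1)]] subrep_act_closed[OF assms(1)]
  by (auto simp: quot_rep_def)

lemma representation_quot: "representation G (quot_rep V U)"
  unfolding representation_def
proof (intro conjI ballI)
  show "module complex_field (quot_rep V U)"
  proof (rule moduleI)
    show "cring complex_field"
      by (rule cring_from_type_algebra)
    show "abelian_group (quot_rep V U)"
    proof (rule abelian_groupI)
      fix x assume x: "x \<in> carrier (quot_rep V U)"
      then obtain v where v: "x = U +>\<^bsub>V\<^esub> v" "v \<in> carrier V"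
        by (auto simp: quot_carrier)
      show "\<exists>y\<in>carrier (quot_rep V U). y \<oplus>\<^bsub>quot_rep V U\<^esub> x = \<zero>\<^bsub>quot_rep V U\<^esub>"
        using v by (intro bexI[of _ "U +>\<^bsub>V\<^esub> (\<ominus>\<^bsub>V\<^esub> v)"])
          (auto simp: quot_carrier quot_add quot_zero V.M.l_neg simp del: V.M.a_coset_add_zero)
    qed (auto simp: quot_carrier quot_add quot_zero V.M.a_ac simp del: V.M.a_coset_add_zero)
  qed (auto simp: quot_carrier quot_add quot_smult rep_smult_add[OF rep_module[OF V]] V.smult_r_distr
      rep_smult_mult[OF rep_module[OF V]] rep_smult_one[OF rep_module[OF V]])
  fix g assume g: "g \<in> carrier G"
  show "act (quot_rep V U) g \<in> lin_hom (quot_rep V U) (quot_rep V U)"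
    using g rep_act_closed[OF V g] lin_homD[OF rep_act_lin[OF V g]]
    by (auto simp: lin_hom_def quot_carrier quot_act quot_add quot_smult)
qed (auto simp: quot_carrier quot_act rep_act_one[OF V] rep_act_mult[OF V] rep_act_closed[OF V])

text \<open>An open subgroup fixing a representative fixes its coset.\<close>

lemma smooth_rep_quot:
  assumes "smooth_rep G T V"
  shows "smooth_rep G T (quot_rep V U)"
  unfolding smooth_rep_def
proof (intro conjI subsetI representation_quot)
  fix y assume "y \<in> carrier (quot_rep V U)"
  then obtain v where v: "y = U +>\<^bsub>V\<^esub> v" "v \<in> carrier V"
    by (auto simp: quot_carrier)
  then obtain K where K: "open_subgroup G T K" "v \<in> fixed_vectors V K"
    using assms by (auto simp: smooth_rep_def smooth_vectors_def)
  have "K \<subseteq> carrier G"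
    using K by (auto simp: open_subgroup_def subgroup.subset)
  then have "y \<in> fixed_vectors (quot_rep V U) K"
    using v K by (auto simp: fixed_vectors_def quot_carrier quot_act subset_iff)
  then show "y \<in> smooth_vectors G T (quot_rep V U)"
    using K by (auto simp: smooth_vectors_def)
qed

text \<open>The descended map evaluates h at a chosen representative. Invariance under U makes the
  choice irrelevant, and linearity and equivariance are then inherited through the projection onto
  cosets.\<close>

lemma G_hom_quot:
  assumes h: "h \<in> G_hom G V M"
    and inv: "\<And>u v. u \<in> U \<Longrightarrow> v \<in> carrier V \<Longrightarrow> h (u \<oplus>\<^bsub>V\<^esub> v) = h v"
  shows "\<exists>h'\<in>G_hom G (quot_rep V U) M. \<forall>v\<in>carrier V. h' (U +>\<^bsub>V\<^esub> v) = h v"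
proof -
  define h' where "h' = (\<lambda>Y. h (SOME v. v \<in> carrier V \<and> U +>\<^bsub>V\<^esub> v = Y))"
  have h': "h' (U +>\<^bsub>V\<^esub> v) = h v" if v: "v \<in> carrier V" for v
  proof -
    let ?w = "SOME w. w \<in> carrier V \<and> U +>\<^bsub>V\<^esub> w = U +>\<^bsub>V\<^esub> v"
    have w: "?w \<in> carrier V \<and> U +>\<^bsub>V\<^esub> ?w = U +>\<^bsub>V\<^esub> v"
      by (rule someI) (use v in auto)
    then obtain u where "u \<in> U" "?w = u \<oplus>\<^bsub>V\<^esub> v"
      using coset_eqD v by blast
    then show ?thesis
      unfolding h'_def using inv v by simp
  qed
  have "h' \<in> G_hom G (quot_rep V U) M"
    using h rep_act_closed[OF V]
    by (auto simp: G_hom_def lin_hom_def Pi_def quot_carrier quot_add quot_smult quot_act h')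
  with h' show ?thesis
    by blast
qed

end

section \<open>Locally constant maps\<close>

lemma locally_constant_compose:
  assumes "locally_constant Y f" "continuous_map S Y p"
  shows "locally_constant S (\<lambda>x. f (p x))"
  unfolding locally_constant_def
proof
  fix x assume x: "x \<in> topspace S"
  then have "p x \<in> topspace Y"
    using assms(2) by (auto simp: continuous_map_def)
  then obtain N where N: "openin Y N" "p x \<in> N" "\<forall>y\<in>N. f y = f (p x)"
    using assms(1) by (auto simp: locally_constant_def)
  show "\<exists>N. openin S N \<and> x \<in> N \<and> (\<forall>y\<in>N. f (p y) = f (p x))"
  proof (intro exI conjI ballI)
    show "openin S {x \<in> topspace S. p x \<in> N}"
      by (rule openin_continuous_map_preimage[OF assms(2) N(1)])
    show "f (p y) = f (p x)" if "y \<in> {x \<in> topspace S. p x \<in> N}" for y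
      using that N(3) by blast
  qed (use x N(2) in blast)
qed

lemma locally_constant_combine:
  assumes "locally_constant S f" "locally_constant S f'"
  shows "locally_constant S (\<lambda>x. h (f x) (f' x))"
  unfolding locally_constant_def
proof
  fix x assume x: "x \<in> topspace S"
  obtain N where N: "openin S N" "x \<in> N" "\<forall>y\<in>N. f y = f x"
    using assms(1) x by (auto simp: locally_constant_def)
  obtain N' where N': "openin S N'" "x \<in> N'" "\<forall>y\<in>N'. f' y = f' x"
    using assms(2) x by (auto simp: locally_constant_def)
  show "\<exists>N. openin S N \<and> x \<in> N \<and> (\<forall>y\<in>N. h (f y) (f' y) = h (f x) (f' x))"
  proof (intro exI conjI ballI)
    show "openin S (N \<inter> N')"
      using N(1) N'(1) by (rule openin_Int)
    show "h (f y) (f' y) = h (f x) (f' x)" if "y \<in> N \<inter> N'" for y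
      using that N(3)[THEN bspec, of y] N'(3)[THEN bspec, of y] by simp
  qed (use N(2) N'(2) in blast)
qed

lemma locally_constant_cong:
  assumes "\<And>x. x \<in> topspace S \<Longrightarrow> f x = f' x"
  shows "locally_constant S f \<longleftrightarrow> locally_constant S f'"
proof -
  have "locally_constant S f'"
    if f: "locally_constant S f" and eq: "\<And>x. x \<in> topspace S \<Longrightarrow> f x = f' x" for f f'
    unfolding locally_constant_def
  proof
    fix x assume x: "x \<in> topspace S"
    then obtain N where N: "openin S N" "x \<in> N" "\<forall>y\<in>N. f y = f x"
      using f by (auto simp: locally_constant_def)
    have "f' y = f' x" if "y \<in> N" for y
      using N(3) that eq[OF x] eq[of y] openin_subset[OF N(1)] by auto
    then show "\<exists>N. openin S N \<and> x \<in> N \<and> (\<forall>y\<in>N. f' y = f' x)"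
      using N by blast
  qed
  from this[of f f'] this[of f' f] show ?thesis
    using assms by auto
qed

lemma l_groupD:
  assumes "l_group G T"
  shows "group G" "topspace T = carrier G"
    "continuous_map (prod_topology T T) T (\<lambda>(x, y). x \<otimes>\<^bsub>G\<^esub> y)"
  using assms by (auto simp: l_group_def)

lemma l_group_translation_continuous:
  assumes "l_group G T" "g \<in> carrier G"
  shows "continuous_map T T (\<lambda>x. g \<otimes>\<^bsub>G\<^esub> x)"
proof -
  have "continuous_map T (prod_topology T T) (\<lambda>x. (g, x))"
    using assms l_groupD[OF assms(1)] by (intro continuous_map_pairedI) auto
  from continuous_map_compose[OF this l_groupD(3)[OF assms(1)]] show ?thesis
    by (simp add: o_def)
qed

lemma open_subgroup_Int:
  assumes "group G" "open_subgroup G T K" "open_subgroup G T K'"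
  shows "open_subgroup G T (K \<inter> K')"
  using assms group.subgroups_Inter_pair by (auto simp: open_subgroup_def)

lemma smooth_repD:
  assumes "smooth_rep G T V"
  shows "representation G V"
    and "v \<in> carrier V \<Longrightarrow> \<exists>K. open_subgroup G T K \<and> v \<in> fixed_vectors V K"
  using assms by (auto simp: smooth_rep_def smooth_vectors_def)

lemma smooth_rep_module: "smooth_rep G T V \<Longrightarrow> module complex_field V"
  by (rule rep_module[OF smooth_repD(1)])

text \<open>Put w = g^-1 v and choose open subgroups \<open>K1\<close> and \<open>K2\<close> fixing
  w and \<eta>(w). For y = g k with k in both, y^-1 v = k^-1 w = w and y \<eta>(w) = g k \<eta>(w) =
  g \<eta>(w), so the value is constant on a left coset.\<close>

lemma locally_constant_conjugate:
  assumes G: "l_group G T" and V: "smooth_rep G T V" and W: "smooth_rep G T W"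
    and \<eta>: "\<And>v. v \<in> carrier V \<Longrightarrow> \<eta> v \<in> carrier W" and v: "v \<in> carrier V"
  shows "locally_constant T (\<lambda>g. act W g (\<eta> (act V (inv\<^bsub>G\<^esub> g) v)))"
  unfolding locally_constant_def
proof
  interpret G: group G
    using G by (rule l_groupD)
  fix g assume "g \<in> topspace T"
  then have g: "g \<in> carrier G"
    using l_groupD(2)[OF G] by simp
  let ?w = "act V (inv\<^bsub>G\<^esub> g) v"
  have w: "?w \<in> carrier V"
    using rep_act_closed[OF smooth_repD(1)[OF V]] g v by simp
  obtain K1 where K1: "open_subgroup G T K1" "?w \<in> fixed_vectors V K1"
    using smooth_repD(2)[OF V w] by blast
  obtain K2 where K2: "open_subgroup G T K2" "\<eta> ?w \<in> fixed_vectors W K2"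
    using smooth_repD(2)[OF W \<eta>[OF w]] by blast
  \<comment> \<open>The left coset of \<open>K1 \<inter> K2\<close> through g, written as a preimage
    under translation so that it is open by continuity.\<close>
  let ?N = "{x \<in> topspace T. inv\<^bsub>G\<^esub> g \<otimes>\<^bsub>G\<^esub> x \<in> K1 \<inter> K2}"
  have K: "subgroup (K1 \<inter> K2) G" "openin T (K1 \<inter> K2)"
    using open_subgroup_Int[OF G.is_group K1(1) K2(1)] by (auto simp: open_subgroup_def)
  show "\<exists>N. openin T N \<and> g \<in> N \<and>
      (\<forall>y\<in>N. act W y (\<eta> (act V (inv\<^bsub>G\<^esub> y) v)) = act W g (\<eta> ?w))"
  proof (intro exI[of _ ?N] conjI ballI)
    show "openin T ?N"
      using g by (intro openin_continuous_map_preimage[OF l_group_translation_continuous[OF G]] K) simp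
    show "g \<in> ?N"
      using g l_groupD(2)[OF G] subgroup.one_closed[OF K(1)] by simp
    fix y assume y: "y \<in> ?N"
    define k where "k = inv\<^bsub>G\<^esub> g \<otimes>\<^bsub>G\<^esub> y"
    have yc: "y \<in> carrier G" and k: "k \<in> K1" "k \<in> K2" "k \<in> carrier G"
      using y g l_groupD(2)[OF G] by (auto simp: k_def)
    have yk: "y = g \<otimes>\<^bsub>G\<^esub> k"
      using yc g by (simp add: k_def G.m_assoc[symmetric])
    have "inv\<^bsub>G\<^esub> k \<in> K1"
      using K1(1) k(1) by (auto simp: open_subgroup_def intro: subgroup.m_inv_closed)
    then have "act V (inv\<^bsub>G\<^esub> k) ?w = ?w"
      using K1(2) by (simp add: fixed_vectors_def)
    then have "act V (inv\<^bsub>G\<^esub> y) v = ?w"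
      using rep_act_mult[OF smooth_repD(1)[OF V], of "inv\<^bsub>G\<^esub> k" "inv\<^bsub>G\<^esub> g" v] g k v
      by (simp add: yk G.inv_mult_group)
    then show "act W y (\<eta> (act V (inv\<^bsub>G\<^esub> y) v)) = act W g (\<eta> ?w)"
      using rep_act_mult[OF smooth_repD(1)[OF W] g k(3) \<eta>[OF w]] K2(2) k(2)
      by (simp add: yk fixed_vectors_def)
  qed
qed

section \<open>The standard resolution in low degrees\<close>

text \<open>The point (g) of \<open>gpow G 0\<close>; restriction makes it extensional, as elements
  of \<open>gpow\<close> have to be.\<close>

definition tuple1 :: "'g \<Rightarrow> nat \<Rightarrow> 'g" where
  "tuple1 g = (\<lambda>k\<in>{..0}. g)"

text \<open>The point (g, h) of \<open>gpow G 1\<close>. At g = 1 it is literally the argument at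
  which \<open>ext1_ident\<close> evaluates.\<close>

definition tuple2 :: "'g \<Rightarrow> 'g \<Rightarrow> nat \<Rightarrow> 'g" where
  "tuple2 g h = (\<lambda>k\<in>{..1}. if k = 0 then g else h)"

lemma tuple_nth [simp]: "tuple1 g 0 = g" "tuple2 g h 0 = g" "tuple2 g h (Suc 0) = h"
  by (simp_all add: tuple1_def tuple2_def)

lemma tuple1_in_gpow: "g \<in> carrier G \<Longrightarrow> tuple1 g \<in> gpow G 0"
  by (auto simp: tuple1_def gpow_def)

lemma tuple2_in_gpow: "g \<in> carrier G \<Longrightarrow> h \<in> carrier G \<Longrightarrow> tuple2 g h \<in> gpow G 1"
  by (auto simp: tuple2_def gpow_def)

lemma gpow_nth: "x \<in> gpow G i \<Longrightarrow> k \<le> i \<Longrightarrow> x k \<in> carrier G"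
  by (auto simp: gpow_def)

lemma gpow_translate:
  "group G \<Longrightarrow> g \<in> carrier G \<Longrightarrow> x \<in> gpow G i \<Longrightarrow> (\<lambda>k\<in>{..i}. inv\<^bsub>G\<^esub> g \<otimes>\<^bsub>G\<^esub> x k) \<in> gpow G i"
  by (auto simp: gpow_def intro!: monoid.m_closed[OF group.is_monoid] group.inv_closed)

lemma std_diff_0:
  assumes B: "module complex_field (B :: ('g, 'b) rep)" and \<phi>: "\<phi> \<in> gpow G 0 \<rightarrow> carrier B"
    and x: "x \<in> gpow G 1"
  shows "std_diff G B 0 \<phi> x = \<phi> (tuple1 (x 1)) \<ominus>\<^bsub>B\<^esub> \<phi> (tuple1 (x 0))"
proof -
  interpret B: module complex_field B by (rule B)
  have c: "\<phi> (tuple1 (x (Suc 0))) \<in> carrier B" "\<phi> (tuple1 (x 0)) \<in> carrier B"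
    by (auto intro!: funcset_mem[OF \<phi>] tuple1_in_gpow gpow_nth[OF x])
  define f where "f = (\<lambda>j. ((-1) ^ j) \<odot>\<^bsub>B\<^esub> \<phi> (\<lambda>k\<in>{..0}. if k < j then x k else x (Suc k)))"
  have "(\<lambda>k\<in>{..0::nat}. if k < 0 then x k else x (Suc k)) = tuple1 (x (Suc 0))"
    "(\<lambda>k\<in>{..0}. if k < Suc 0 then x k else x (Suc k)) = tuple1 (x 0)"
    by (auto simp: tuple1_def)
  then have f: "f 0 = \<phi> (tuple1 (x (Suc 0)))" "f (Suc 0) = \<ominus>\<^bsub>B\<^esub> \<phi> (tuple1 (x 0))"
    using c by (simp_all add: f_def rep_smult_one[OF B] rep_smult_minus[OF B])
  have "std_diff G B 0 \<phi> x = (\<Oplus>\<^bsub>B\<^esub>j\<in>{..Suc 0}. f j)"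
    using x by (simp add: std_diff_def f_def)
  also have "\<dots> = f (Suc 0) \<oplus>\<^bsub>B\<^esub> f 0"
    using c f by (subst B.M.finsum_Suc) (auto simp: le_Suc_eq)
  finally show ?thesis
    using c f by (simp add: a_minus_def B.M.a_comm)
qed

text \<open>The summand with index j omits the entry \<open>x j\<close>. The two positive terms are
  grouped so that vanishing has the shape of the 1-cocycle identity.\<close>

lemma std_diff_1:
  assumes B: "module complex_field (B :: ('g, 'b) rep)" and \<phi>: "\<phi> \<in> gpow G 1 \<rightarrow> carrier B"
    and x: "x \<in> gpow G 2"
  shows "std_diff G B 1 \<phi> x =
    (\<phi> (tuple2 (x 1) (x 2)) \<oplus>\<^bsub>B\<^esub> \<phi> (tuple2 (x 0) (x 1))) \<ominus>\<^bsub>B\<^esub> \<phi> (tuple2 (x 0) (x 2))"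
proof -
  interpret B: module complex_field B by (rule B)
  have c: "\<phi> (tuple2 (x i) (x j)) \<in> carrier B" if "i \<le> 2" "j \<le> 2" for i j
    using that by (auto intro!: funcset_mem[OF \<phi>] tuple2_in_gpow gpow_nth[OF x])
  define f where "f = (\<lambda>j. ((-1) ^ j) \<odot>\<^bsub>B\<^esub> \<phi> (\<lambda>k\<in>{..1}. if k < j then x k else x (Suc k)))"
  have "(\<lambda>k\<in>{..1::nat}. if k < 0 then x k else x (Suc k)) = tuple2 (x 1) (x 2)"
    "(\<lambda>k\<in>{..1}. if k < Suc 0 then x k else x (Suc k)) = tuple2 (x 0) (x 2)"
    "(\<lambda>k\<in>{..1}. if k < Suc (Suc 0) then x k else x (Suc k)) = tuple2 (x 0) (x 1)"
    by (auto simp: tuple2_def fun_eq_iff restrict_def le_Suc_eq numeral_2_eq_2)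
  then have f: "f 0 = \<phi> (tuple2 (x 1) (x 2))" "f (Suc 0) = \<ominus>\<^bsub>B\<^esub> \<phi> (tuple2 (x 0) (x 2))"
    "f (Suc (Suc 0)) = \<phi> (tuple2 (x 0) (x 1))"
    using c[of 1 2] c[of 0 2] c[of 0 1]
    by (simp_all add: f_def rep_smult_one[OF B] rep_smult_minus[OF B])
  have fc: "f 0 \<in> carrier B" "f (Suc 0) \<in> carrier B" "f (Suc (Suc 0)) \<in> carrier B"
    unfolding f using c[of 1 2] c[of 0 2] c[of 0 1] by auto
  have "std_diff G B 1 \<phi> x = (\<Oplus>\<^bsub>B\<^esub>j\<in>{..Suc (Suc 0)}. f j)"
    using x by (simp add: std_diff_def f_def numeral_2_eq_2)
  also have "\<dots> = f (Suc (Suc 0)) \<oplus>\<^bsub>B\<^esub> (f (Suc 0) \<oplus>\<^bsub>B\<^esub> f 0)"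
    using fc by (subst B.M.finsum_Suc, force simp: le_Suc_eq)
      (subst B.M.finsum_Suc, auto simp: le_Suc_eq)
  finally show ?thesis
    using fc c[of 1 2] c[of 0 2] c[of 0 1] unfolding f by (simp add: a_minus_def B.M.a_ac)
qed

lemma std_diff_0_diff:
  assumes B: "module complex_field (B :: ('g, 'b) rep)"
    and \<phi>: "\<phi> \<in> gpow G 0 \<rightarrow> carrier B" "\<theta> \<in> gpow G 0 \<rightarrow> carrier B" and x: "x \<in> gpow G 1"
  shows "std_diff G B 0 (\<lambda>y\<in>gpow G 0. \<phi> y \<ominus>\<^bsub>B\<^esub> \<theta> y) x = std_diff G B 0 \<phi> x \<ominus>\<^bsub>B\<^esub> std_diff G B 0 \<theta> x"
proof -
  interpret B: module complex_field B by (rule B)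
  have t: "tuple1 (x 1) \<in> gpow G 0" "tuple1 (x 0) \<in> gpow G 0"
    using gpow_nth[OF x] by (auto intro: tuple1_in_gpow)
  have c: "\<phi> (tuple1 (x 1)) \<in> carrier B" "\<phi> (tuple1 (x 0)) \<in> carrier B"
    "\<theta> (tuple1 (x 1)) \<in> carrier B" "\<theta> (tuple1 (x 0)) \<in> carrier B"
    using \<phi> t by auto
  have "(\<lambda>y\<in>gpow G 0. \<phi> y \<ominus>\<^bsub>B\<^esub> \<theta> y) \<in> gpow G 0 \<rightarrow> carrier B"
    using \<phi> by auto
  then show ?thesis
    using t c by (simp add: std_diff_0[OF B _ x] \<phi> a_minus_def B.M.minus_add B.M.a_ac)
qed

lemma std_diff_std_diff:
  assumes B: "module complex_field (B :: ('g, 'b) rep)" and \<phi>: "\<phi> \<in> gpow G 0 \<rightarrow> carrier B"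
  shows "std_diff G B 1 (std_diff G B 0 \<phi>) = \<zero>\<^bsub>std_res G T B 2\<^esub>"
proof -
  interpret B: module complex_field B by (rule B)
  have c: "\<phi> (tuple1 g) \<in> carrier B" if "g \<in> carrier G" for g
    using \<phi> tuple1_in_gpow[OF that] by auto
  have d: "std_diff G B 0 \<phi> \<in> gpow G 1 \<rightarrow> carrier B"
  proof
    fix x assume "x \<in> gpow G 1"
    then show "std_diff G B 0 \<phi> x \<in> carrier B"
      using c gpow_nth[of x G 1] by (simp add: std_diff_0[OF B \<phi>])
  qed
  have "std_diff G B 1 (std_diff G B 0 \<phi>) x = \<zero>\<^bsub>B\<^esub>" if x: "x \<in> gpow G 2" for x
  proof -
    have n: "x 0 \<in> carrier G" "x 1 \<in> carrier G" "x 2 \<in> carrier G"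
      using gpow_nth[OF x] by auto
    have t: "std_diff G B 0 \<phi> (tuple2 g h) = \<phi> (tuple1 h) \<ominus>\<^bsub>B\<^esub> \<phi> (tuple1 g)"
      if "g \<in> carrier G" "h \<in> carrier G" for g h
      using std_diff_0[OF B \<phi> tuple2_in_gpow[OF that]] by simp
    have alg: "((r \<ominus>\<^bsub>B\<^esub> q) \<oplus>\<^bsub>B\<^esub> (q \<ominus>\<^bsub>B\<^esub> p)) \<ominus>\<^bsub>B\<^esub> (r \<ominus>\<^bsub>B\<^esub> p) = \<zero>\<^bsub>B\<^esub>"
      if "p \<in> carrier B" "q \<in> carrier B" "r \<in> carrier B" for p q r
      using that by (simp add: a_minus_def B.M.minus_add B.M.a_assoc B.M.a_comm[of "\<ominus>\<^bsub>B\<^esub> r" p]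
          B.M.r_neg B.M.r_neg1)
    show ?thesis
      unfolding std_diff_1[OF B d x] t[OF n(2,3)] t[OF n(1,2)] t[OF n(1,3)]
      using c n by (intro alg)
  qed
  \<comment> \<open>The claim is an equality of functions: outside \<open>gpow G 2\<close> both
    sides take the default value \<open>undefined\<close>.\<close>
  moreover have "std_diff G B 1 (std_diff G B 0 \<phi>) x = undefined" if "x \<notin> gpow G 2" for x
    using that by (simp add: std_diff_def numeral_2_eq_2)
  ultimately show ?thesis
    by (auto simp: std_res_def sub_rep_def loc_const_rep_def restrict_def fun_eq_iff)
qed

lemma std_res_simps:
  "\<zero>\<^bsub>std_res G T B i\<^esub> = (\<lambda>x\<in>gpow G i. \<zero>\<^bsub>B\<^esub>)"
  "\<phi> \<oplus>\<^bsub>std_res G T B i\<^esub> \<theta> = (\<lambda>x\<in>gpow G i. \<phi> x \<oplus>\<^bsub>B\<^esub> \<theta> x)"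
  "a \<odot>\<^bsub>std_res G T B i\<^esub> \<phi> = (\<lambda>x\<in>gpow G i. a \<odot>\<^bsub>B\<^esub> \<phi> x)"
  "act (std_res G T B i) g \<phi> =
    (\<lambda>x\<in>gpow G i. act B g (\<phi> (\<lambda>k\<in>{..i}. inv\<^bsub>G\<^esub> g \<otimes>\<^bsub>G\<^esub> x k)))"
  by (simp_all add: std_res_def sub_rep_def loc_const_rep_def)

lemma std_res_carrier_iff:
  "\<phi> \<in> carrier (std_res G T B i) \<longleftrightarrow> \<phi> \<in> gpow G i \<rightarrow>\<^sub>E carrier B \<and>
     locally_constant (product_topology (\<lambda>_. T) {..i}) \<phi> \<and>
     (\<exists>K. open_subgroup G T K \<and> (\<forall>k\<in>K. act (std_res G T B i) k \<phi> = \<phi>))"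
  by (auto simp: std_res_def sub_rep_def loc_const_rep_def smooth_vectors_def fixed_vectors_def)

lemma std_resD:
  assumes "\<phi> \<in> carrier (std_res G T B i)"
  shows "\<phi> \<in> gpow G i \<rightarrow>\<^sub>E carrier B" "\<phi> \<in> gpow G i \<rightarrow> carrier B"
    "locally_constant (product_topology (\<lambda>_. T) {..i}) \<phi>"
  using assms unfolding std_res_carrier_iff by (auto simp: PiE_def)

lemma G_hom_std_resD:
  assumes "E \<in> G_hom G A (std_res G T B i)"
  shows "a \<in> carrier A \<Longrightarrow> E a \<in> carrier (std_res G T B i)"
    and "a \<in> carrier A \<Longrightarrow> a' \<in> carrier A \<Longrightarrow> x \<in> gpow G i \<Longrightarrow> E (a \<oplus>\<^bsub>A\<^esub> a') x = E a x \<oplus>\<^bsub>B\<^esub> E a' x"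
    and "a \<in> carrier A \<Longrightarrow> x \<in> gpow G i \<Longrightarrow> E (c \<odot>\<^bsub>A\<^esub> a) x = c \<odot>\<^bsub>B\<^esub> E a x"
    and "g \<in> carrier G \<Longrightarrow> a \<in> carrier A \<Longrightarrow> x \<in> gpow G i \<Longrightarrow>
      E (act A g a) x = act B g (E a (\<lambda>k\<in>{..i}. inv\<^bsub>G\<^esub> g \<otimes>\<^bsub>G\<^esub> x k))"
  using assms by (auto simp: G_hom_def lin_hom_def std_res_simps Pi_iff)

text \<open>Membership in \<open>std_res\<close> asks each \<open>E a\<close> to be a smooth vector.
  This is automatic for an equivariant E on a smooth representation: whatever fixes a fixes
  \<open>E a\<close>. Pointwise conditions therefore suffice.\<close>

lemma G_hom_std_resI:
  assumes A: "smooth_rep G T A" and B: "representation G B"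
    and E: "\<And>a. a \<in> carrier A \<Longrightarrow> E a \<in> gpow G i \<rightarrow>\<^sub>E carrier B"
    and lc: "\<And>a. a \<in> carrier A \<Longrightarrow> locally_constant (product_topology (\<lambda>_. T) {..i}) (E a)"
    and add: "\<And>a a' x. a \<in> carrier A \<Longrightarrow> a' \<in> carrier A \<Longrightarrow> x \<in> gpow G i \<Longrightarrow>
      E (a \<oplus>\<^bsub>A\<^esub> a') x = E a x \<oplus>\<^bsub>B\<^esub> E a' x"
    and smult: "\<And>a c x. a \<in> carrier A \<Longrightarrow> x \<in> gpow G i \<Longrightarrow> E (c \<odot>\<^bsub>A\<^esub> a) x = c \<odot>\<^bsub>B\<^esub> E a x"
    and act: "\<And>g a x. g \<in> carrier G \<Longrightarrow> a \<in> carrier A \<Longrightarrow> x \<in> gpow G i \<Longrightarrow>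
      E (act A g a) x = act B g (E a (\<lambda>k\<in>{..i}. inv\<^bsub>G\<^esub> g \<otimes>\<^bsub>G\<^esub> x k))"
  shows "E \<in> G_hom G A (std_res G T B i)"
proof -
  have rep_A: "representation G A"
    using A by (rule smooth_repD)
  interpret A: module complex_field A
    by (rule rep_module[OF rep_A])
  \<comment> \<open>Values of E are extensional, so equations between them may be checked at the
    points of \<open>gpow G i\<close>.\<close>
  have ext: "E a = (\<lambda>x\<in>gpow G i. f x)"
    if "a \<in> carrier A" "\<And>x. x \<in> gpow G i \<Longrightarrow> E a x = f x" for a f
    using E[OF that(1)] that(2) by (auto intro!: extensionalityI[of _ "gpow G i"] simp: PiE_def)
  have eq: "E (act A g a) = act (std_res G T B i) g (E a)" if "g \<in> carrier G" "a \<in> carrier A" for g a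
    unfolding std_res_simps using rep_act_closed[OF rep_A that] act[OF that] by (rule ext)
  have "E a \<in> carrier (std_res G T B i)" if a: "a \<in> carrier A" for a
  proof -
    obtain K where K: "open_subgroup G T K" "a \<in> fixed_vectors A K"
      using smooth_repD(2)[OF A a] by blast
    have "act (std_res G T B i) k (E a) = E a" if "k \<in> K" for k
    proof -
      have "k \<in> carrier G"
        using K(1) that by (auto simp: open_subgroup_def dest: subgroup.subset)
      then show ?thesis
        using eq[OF _ a, of k] K(2) that by (simp add: fixed_vectors_def)
    qed
    then show ?thesis
      unfolding std_res_carrier_iff using E lc a K(1) by blast
  qed
  moreover have "E (a \<oplus>\<^bsub>A\<^esub> a') = E a \<oplus>\<^bsub>std_res G T B i\<^esub> E a'"
    if "a \<in> carrier A" "a' \<in> carrier A" for a a'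
    unfolding std_res_simps using that add by (intro ext) auto
  moreover have "E (c \<odot>\<^bsub>A\<^esub> a) = c \<odot>\<^bsub>std_res G T B i\<^esub> E a" if "a \<in> carrier A" for a c
    unfolding std_res_simps using that smult by (intro ext) auto
  ultimately show ?thesis
    using eq by (simp add: G_hom_def lin_hom_def)
qed

lemma continuous_map_tuple1:
  "j \<le> (i :: nat) \<Longrightarrow> continuous_map (product_topology (\<lambda>_. T) {..i}) (product_topology (\<lambda>_. T)
      {..0}) (\<lambda>x. tuple1 (x j))"
  by (auto simp: continuous_map_componentwise tuple1_def restrict_def extensional_def
      intro!: continuous_map_product_projection)

lemma continuous_map_tuple2:
  "g \<in> topspace T \<Longrightarrow> continuous_map T (product_topology (\<lambda>_. T) {..1}) (\<lambda>h. tuple2 g h)"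
  by (auto simp: continuous_map_componentwise tuple2_def restrict_def extensional_def)

lemma topspace_gpow: "l_group G T \<Longrightarrow> topspace (product_topology (\<lambda>_. T) {..i}) = gpow G i"
  by (simp add: gpow_def l_groupD)

lemma locally_constant_restrict_gpow:
  "l_group G T \<Longrightarrow> locally_constant (product_topology (\<lambda>_. T) {..i}) (\<lambda>x\<in>gpow G i. f x) \<longleftrightarrow>
    locally_constant (product_topology (\<lambda>_. T) {..i}) f"
  by (rule locally_constant_cong) (simp only: topspace_gpow restrict_apply')

section \<open>One-cocycles\<close>

lemma coh1_rel_iff:
  "(\<psi>, \<psi>') \<in> coh1_rel G T A B \<longleftrightarrow> \<psi> \<in> cocycles1 G T A B \<and> \<psi>' \<in> cocycles1 G T A B \<and>
     (\<exists>\<eta>\<in>lin_hom A B. \<forall>g\<in>carrier G. \<forall>a\<in>carrier A.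
        \<psi>' g a = \<psi> g a \<oplus>\<^bsub>B\<^esub> coboundary1 G A B \<eta> g a)"
  by (simp add: coh1_rel_def)

text \<open>For relations of the form "differ by a coboundary" the Euclidean law is a single
  subtraction, and it yields symmetry and transitivity together.\<close>

lemma equiv_if_euclidean:
  assumes "r \<subseteq> S \<times> S" "\<And>x. x \<in> S \<Longrightarrow> (x, x) \<in> r"
    and "\<And>x y z. (x, y) \<in> r \<Longrightarrow> (x, z) \<in> r \<Longrightarrow> (y, z) \<in> r"
  shows "equiv S r"
proof (rule equivI)
  show "refl_on S r"
    using assms(2) by (rule refl_onI)
  show "sym r"
    using assms(1,2,3) by (intro symI) blast
  then show "trans r"
    using assms(3) by (meson symE transI)
qed (rule assms(1))

context
  fixes G :: "('g, 'm) monoid_scheme" and T :: "'g topology"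
    and A :: "('g, 'a) rep" and B :: "('g, 'b) rep"
  assumes G: "l_group G T" and A: "smooth_rep G T A" and B: "smooth_rep G T B"
begin

interpretation G: group G
  using G by (rule l_groupD)

interpretation B: module complex_field B
  by (rule smooth_rep_module[OF B])

lemma coboundary1_lin_hom:
  assumes "\<eta> \<in> lin_hom A B" "g \<in> carrier G"
  shows "coboundary1 G A B \<eta> g \<in> lin_hom A B"
proof -
  have "(\<lambda>a. act B g (\<eta> (act A (inv\<^bsub>G\<^esub> g) a))) \<in> lin_hom A B"
    using assms lin_homD[OF assms(1)] lin_homD[OF rep_act_lin[OF smooth_repD(1)[OF A], of "inv\<^bsub>G\<^esub> g"]]
      lin_homD[OF rep_act_lin[OF smooth_repD(1)[OF B], of g]]
    by (simp add: lin_hom_def)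
  from lin_hom_diff[OF smooth_rep_module[OF B] this assms(1)] show ?thesis
    by (simp add: coboundary1_def[abs_def])
qed

lemma coboundary1_diff:
  assumes "\<eta> \<in> lin_hom A B" "\<eta>' \<in> lin_hom A B" "g \<in> carrier G" "a \<in> carrier A"
  shows "coboundary1 G A B (\<lambda>a. \<eta> a \<ominus>\<^bsub>B\<^esub> \<eta>' a) g a =
    coboundary1 G A B \<eta> g a \<ominus>\<^bsub>B\<^esub> coboundary1 G A B \<eta>' g a"
proof -
  let ?x = "\<eta> (act A (inv\<^bsub>G\<^esub> g) a)" and ?y = "\<eta>' (act A (inv\<^bsub>G\<^esub> g) a)"
  have c: "?x \<in> carrier B" "?y \<in> carrier B" "\<eta> a \<in> carrier B" "\<eta>' a \<in> carrier B"
    "act B g ?x \<in> carrier B" "act B g ?y \<in> carrier B"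
    using assms by (auto intro!: lin_hom_closed[OF assms(1)] lin_hom_closed[OF assms(2)]
        rep_act_closed[OF smooth_repD(1)[OF A]] rep_act_closed[OF smooth_repD(1)[OF B]])
  have "act B g (?x \<ominus>\<^bsub>B\<^esub> ?y) = act B g ?x \<ominus>\<^bsub>B\<^esub> act B g ?y"
    using c by (intro lin_hom_diff_arg[OF rep_act_lin[OF smooth_repD(1)[OF B] assms(3)]
        smooth_rep_module[OF B] smooth_rep_module[OF B]])
  then show ?thesis
    using c by (simp add: coboundary1_def a_minus_def B.M.minus_add B.M.a_ac)
qed

text \<open>The identity telescopes through the middle term g \<eta>(g^-1 a). Local constancy comes
  from smoothness of both representations, by \<open>locally_constant_conjugate\<close>.\<close>

lemma coboundary1_cocycle:
  assumes \<eta>: "\<eta> \<in> lin_hom A B"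
  shows "coboundary1 G A B \<eta> \<in> cocycles1 G T A B"
  unfolding cocycles1_def
proof (intro CollectI conjI ballI)
  note [simp] = lin_hom_closed[OF \<eta>] rep_act_closed[OF smooth_repD(1)[OF A]] rep_act_closed[OF
      smooth_repD(1)[OF B]]
  show "coboundary1 G A B \<eta> g \<in> lin_hom A B" if "g \<in> carrier G" for g
    using \<eta> that by (rule coboundary1_lin_hom)
  show "locally_constant T (\<lambda>g. coboundary1 G A B \<eta> g a)" if "a \<in> carrier A" for a
    unfolding coboundary1_def using that
    by (intro locally_constant_combine[where h = "\<lambda>x y. x \<ominus>\<^bsub>B\<^esub> y"] locally_constant_conjugate[OF G A B])
      (auto simp: locally_constant_def)
  fix g h a assume ga: "g \<in> carrier G" "h \<in> carrier G" "a \<in> carrier A"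
  let ?a = "act A (inv\<^bsub>G\<^esub> g) a"
  let ?x = "act B h (\<eta> (act A (inv\<^bsub>G\<^esub> h) ?a))"
  have c: "act B g ?x \<in> carrier B" "act B g (\<eta> ?a) \<in> carrier B" "\<eta> a \<in> carrier B"
    using ga by auto
  have "act B g (coboundary1 G A B \<eta> h ?a) = act B g ?x \<ominus>\<^bsub>B\<^esub> act B g (\<eta> ?a)"
    unfolding coboundary1_def using ga
    by (intro lin_hom_diff_arg[OF rep_act_lin[OF smooth_repD(1)[OF B]] smooth_rep_module[OF B]
        smooth_rep_module[OF B]]) auto
  moreover have "act B (g \<otimes>\<^bsub>G\<^esub> h) (\<eta> (act A (inv\<^bsub>G\<^esub> (g \<otimes>\<^bsub>G\<^esub> h)) a)) = act B g ?x"
    using ga by (simp add: G.inv_mult_group rep_act_mult[OF smooth_repD(1)[OF A]] rep_act_mult[OF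
        smooth_repD(1)[OF B]])
  moreover have "act B g ?x \<ominus>\<^bsub>B\<^esub> \<eta> a =
      (act B g ?x \<ominus>\<^bsub>B\<^esub> act B g (\<eta> ?a)) \<oplus>\<^bsub>B\<^esub> (act B g (\<eta> ?a) \<ominus>\<^bsub>B\<^esub> \<eta> a)"
    using c by (simp add: a_minus_def B.M.a_assoc B.M.r_neg1)
  ultimately show "coboundary1 G A B \<eta> (g \<otimes>\<^bsub>G\<^esub> h) a =
      act B g (coboundary1 G A B \<eta> h ?a) \<oplus>\<^bsub>B\<^esub> coboundary1 G A B \<eta> g a"
    by (simp add: coboundary1_def)
qed

lemma coh1_rel_equiv: "equiv (cocycles1 G T A B) (coh1_rel G T A B)"
proof (rule equiv_if_euclidean)
  have cl: "\<psi> g a \<in> carrier B" if "\<psi> \<in> cocycles1 G T A B" "g \<in> carrier G" "a \<in> carrier A" for \<psi> g a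
    using that lin_hom_closed[of "\<psi> g" A B] by (auto simp: cocycles1_def)
  show "(\<psi>, \<psi>) \<in> coh1_rel G T A B" if "\<psi> \<in> cocycles1 G T A B" for \<psi>
  proof -
    have "coboundary1 G A B (\<lambda>_. \<zero>\<^bsub>B\<^esub>) g a = \<zero>\<^bsub>B\<^esub>" if "g \<in> carrier G" for g a
      using that lin_hom_smult[OF rep_act_lin[OF smooth_repD(1)[OF B] that], of "\<zero>\<^bsub>B\<^esub>" 0]
          rep_act_closed[OF smooth_repD(1)[OF B] that, of "\<zero>\<^bsub>B\<^esub>"]
      by (simp add: coboundary1_def a_minus_def rep_smult_zero[OF smooth_rep_module[OF B]])
    then have "\<forall>g\<in>carrier G. \<forall>a\<in>carrier A. \<psi> g a = \<psi> g a \<oplus>\<^bsub>B\<^esub> coboundary1 G A B (\<lambda>_. \<zero>\<^bsub>B\<^esub>) g a"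
      using cl[OF that] by simp
    then show ?thesis
      unfolding coh1_rel_iff using that lin_hom_zero[OF smooth_rep_module[OF B], of A] by blast
  qed
  fix \<psi> \<psi>1 \<psi>2 assume "(\<psi>, \<psi>1) \<in> coh1_rel G T A B" "(\<psi>, \<psi>2) \<in> coh1_rel G T A B"
  then obtain \<eta>1 \<eta>2 where \<psi>: "\<psi> \<in> cocycles1 G T A B" "\<psi>1 \<in> cocycles1 G T A B" "\<psi>2 \<in> cocycles1 G T A B"
    and \<eta>: "\<eta>1 \<in> lin_hom A B" "\<eta>2 \<in> lin_hom A B"
    and eq: "\<forall>g\<in>carrier G. \<forall>a\<in>carrier A. \<psi>1 g a = \<psi> g a \<oplus>\<^bsub>B\<^esub> coboundary1 G A B \<eta>1 g a"
      "\<forall>g\<in>carrier G. \<forall>a\<in>carrier A. \<psi>2 g a = \<psi> g a \<oplus>\<^bsub>B\<^esub> coboundary1 G A B \<eta>2 g a"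
    unfolding coh1_rel_iff by blast
  have "\<psi>2 g a = \<psi>1 g a \<oplus>\<^bsub>B\<^esub> coboundary1 G A B (\<lambda>a. \<eta>2 a \<ominus>\<^bsub>B\<^esub> \<eta>1 a) g a"
    if "g \<in> carrier G" "a \<in> carrier A" for g a
  proof -
    have "coboundary1 G A B \<eta>1 g a \<in> carrier B" "coboundary1 G A B \<eta>2 g a \<in> carrier B"
      using lin_hom_closed[OF coboundary1_lin_hom[OF \<eta>(1) that(1)] that(2)]
        lin_hom_closed[OF coboundary1_lin_hom[OF \<eta>(2) that(1)] that(2)] .
    then show ?thesis
      unfolding coboundary1_diff[OF \<eta>(2,1) that] eq(1)[rule_format, OF that] eq(2)[rule_format, OF that]
      using cl[OF \<psi>(1) that] by (intro module_add_via[OF smooth_rep_module[OF B]])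
  qed
  then show "(\<psi>1, \<psi>2) \<in> coh1_rel G T A B"
    unfolding coh1_rel_iff using \<psi> lin_hom_diff[OF smooth_rep_module[OF B] \<eta>(2,1)] by blast
next
  show "coh1_rel G T A B \<subseteq> cocycles1 G T A B \<times> cocycles1 G T A B"
    unfolding coh1_rel_def by blast
qed

interpretation A: module complex_field A
  by (rule smooth_rep_module[OF A])

section \<open>Equivariant maps into the standard resolution and their first cohomology\<close>

lemma G_hom_std_res_zero: "(\<lambda>a. \<lambda>x\<in>gpow G i. \<zero>\<^bsub>B\<^esub>) \<in> G_hom G A (std_res G T B i)"
proof (rule G_hom_std_resI[OF A smooth_repD(1)[OF B]])
  fix a
  show "locally_constant (product_topology (\<lambda>_. T) {..i}) (\<lambda>x\<in>gpow G i. \<zero>\<^bsub>B\<^esub>)"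
    unfolding locally_constant_restrict_gpow[OF G] by (auto simp: locally_constant_def)
next
  fix g x assume "g \<in> carrier G" "x \<in> gpow G i"
  moreover from this(1) have "act B g \<zero>\<^bsub>B\<^esub> = \<zero>\<^bsub>B\<^esub>"
    using lin_hom_smult[OF rep_act_lin[OF smooth_repD(1)[OF B]], of g "\<zero>\<^bsub>B\<^esub>" 0] rep_act_closed[OF
        smooth_repD(1)[OF B], of g "\<zero>\<^bsub>B\<^esub>"]
    by (simp add: rep_smult_zero[OF smooth_rep_module[OF B]])
  ultimately show "(\<lambda>x\<in>gpow G i. \<zero>\<^bsub>B\<^esub>) x =
      act B g ((\<lambda>x\<in>gpow G i. \<zero>\<^bsub>B\<^esub>) (\<lambda>k\<in>{..i}. inv\<^bsub>G\<^esub> g \<otimes>\<^bsub>G\<^esub> x k))"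
    using gpow_translate[OF G.is_group] by simp
qed (use B.smult_r_null in auto)

lemma G_hom_std_res_diff:
  assumes E: "E \<in> G_hom G A (std_res G T B i)" and E': "E' \<in> G_hom G A (std_res G T B i)"
  shows "(\<lambda>a. \<lambda>x\<in>gpow G i. E a x \<ominus>\<^bsub>B\<^esub> E' a x) \<in> G_hom G A (std_res G T B i)"
proof (rule G_hom_std_resI[OF A smooth_repD(1)[OF B]])
  have c: "E a x \<in> carrier B" "E' a x \<in> carrier B" if "a \<in> carrier A" "x \<in> gpow G i" for a x
    using std_resD(2)[OF G_hom_std_resD(1)[OF E that(1)]] std_resD(2)[OF G_hom_std_resD(1)[OF E'
        that(1)]]
      that(2) by auto
  fix a assume a: "a \<in> carrier A"
  show "(\<lambda>x\<in>gpow G i. E a x \<ominus>\<^bsub>B\<^esub> E' a x) \<in> gpow G i \<rightarrow>\<^sub>E carrier B"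
    using c[OF a] by auto
  have "locally_constant (product_topology (\<lambda>_. T) {..i}) (\<lambda>x. E a x \<ominus>\<^bsub>B\<^esub> E' a x)"
    by (intro locally_constant_combine[where h = "\<lambda>x y. x \<ominus>\<^bsub>B\<^esub> y"]
        std_resD(3)[OF G_hom_std_resD(1)[OF E a]] std_resD(3)[OF G_hom_std_resD(1)[OF E' a]])
  then show "locally_constant (product_topology (\<lambda>_. T) {..i}) (\<lambda>x\<in>gpow G i. E a x \<ominus>\<^bsub>B\<^esub> E' a x)"
    unfolding locally_constant_restrict_gpow[OF G] .
  fix x assume x: "x \<in> gpow G i"
  show "(\<lambda>x\<in>gpow G i. E (a \<oplus>\<^bsub>A\<^esub> a') x \<ominus>\<^bsub>B\<^esub> E' (a \<oplus>\<^bsub>A\<^esub> a') x) x =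
      (\<lambda>x\<in>gpow G i. E a x \<ominus>\<^bsub>B\<^esub> E' a x) x \<oplus>\<^bsub>B\<^esub> (\<lambda>x\<in>gpow G i. E a' x \<ominus>\<^bsub>B\<^esub> E' a' x) x"
    if a': "a' \<in> carrier A" for a'
    using x c[OF a x] c[OF a' x]
    by (simp add: G_hom_std_resD(2)[OF E a a' x] G_hom_std_resD(2)[OF E' a a' x]
        module_diff_sums[OF smooth_rep_module[OF B]])
  show "(\<lambda>x\<in>gpow G i. E (r \<odot>\<^bsub>A\<^esub> a) x \<ominus>\<^bsub>B\<^esub> E' (r \<odot>\<^bsub>A\<^esub> a) x) x =
      r \<odot>\<^bsub>B\<^esub> (\<lambda>x\<in>gpow G i. E a x \<ominus>\<^bsub>B\<^esub> E' a x) x" for r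
    using x c[OF a x]
    by (simp add: G_hom_std_resD(3)[OF E a x] G_hom_std_resD(3)[OF E' a x] module_smult_diff[OF
        smooth_rep_module[OF B]])
  show "(\<lambda>x\<in>gpow G i. E (act A g a) x \<ominus>\<^bsub>B\<^esub> E' (act A g a) x) x =
      act B g ((\<lambda>x\<in>gpow G i. E a x \<ominus>\<^bsub>B\<^esub> E' a x) (\<lambda>k\<in>{..i}. inv\<^bsub>G\<^esub> g \<otimes>\<^bsub>G\<^esub> x k))"
    if g: "g \<in> carrier G" for g
    using x gpow_translate[OF G.is_group g x] c[OF a gpow_translate[OF G.is_group g x]]
    by (simp add: G_hom_std_resD(4)[OF E g a x] G_hom_std_resD(4)[OF E' g a x]
        lin_hom_diff_arg[OF rep_act_lin[OF smooth_repD(1)[OF B] g] smooth_rep_module[OF B]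
            smooth_rep_module[OF B]])
qed

lemma G_hom_std_diff_0:
  assumes E: "E \<in> G_hom G A (std_res G T B 0)"
  shows "(\<lambda>a. std_diff G B 0 (E a)) \<in> G_hom G A (std_res G T B 1)"
proof (rule G_hom_std_resI[OF A smooth_repD(1)[OF B]])
  have \<phi>: "E a \<in> gpow G 0 \<rightarrow> carrier B" if "a \<in> carrier A" for a
    using std_resD(2)[OF G_hom_std_resD(1)[OF E that]] .
  have t: "tuple1 (x 0) \<in> gpow G 0" "tuple1 (x 1) \<in> gpow G 0" if "x \<in> gpow G 1" for x
    using gpow_nth[OF that] by (auto intro: tuple1_in_gpow)
  have c: "E a (tuple1 (x 0)) \<in> carrier B" "E a (tuple1 (x 1)) \<in> carrier B"
    if "a \<in> carrier A" "x \<in> gpow G 1" for a x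
    using \<phi>[OF that(1)] t[OF that(2)] by auto
  fix a assume a: "a \<in> carrier A"
  show "std_diff G B 0 (E a) \<in> gpow G 1 \<rightarrow>\<^sub>E carrier B"
  proof (rule PiE_I)
    show "std_diff G B 0 (E a) x \<in> carrier B" if "x \<in> gpow G 1" for x
      unfolding std_diff_0[OF smooth_rep_module[OF B] \<phi>[OF a] that] using c[OF a that] by simp
  qed (simp add: std_diff_def)
  have "locally_constant (product_topology (\<lambda>_. T) {..1::nat})
      (\<lambda>x. E a (tuple1 (x 1)) \<ominus>\<^bsub>B\<^esub> E a (tuple1 (x 0)))"
    by (intro locally_constant_combine[where h = "\<lambda>x y. x \<ominus>\<^bsub>B\<^esub> y"]
        locally_constant_compose[OF std_resD(3)[OF G_hom_std_resD(1)[OF E a]]]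
            continuous_map_tuple1) auto
  then show "locally_constant (product_topology (\<lambda>_. T) {..1}) (std_diff G B 0 (E a))"
    by (subst locally_constant_cong[where f' = "\<lambda>x. E a (tuple1 (x 1)) \<ominus>\<^bsub>B\<^esub> E a (tuple1 (x 0))"])
      (simp_all only: topspace_gpow[OF G] std_diff_0[OF smooth_rep_module[OF B] \<phi>[OF a]])
  fix x assume x: "x \<in> gpow G 1"
  note d = std_diff_0[OF smooth_rep_module[OF B] \<phi> x]
  show "std_diff G B 0 (E (a \<oplus>\<^bsub>A\<^esub> a')) x = std_diff G B 0 (E a) x \<oplus>\<^bsub>B\<^esub> std_diff G B 0 (E a') x"
    if a': "a' \<in> carrier A" for a'
    unfolding d[OF a] d[OF a'] d[OF A.a_closed[OF a a']] G_hom_std_resD(2)[OF E a a' t(1)[OF x]]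
      G_hom_std_resD(2)[OF E a a' t(2)[OF x]]
    using c[OF a x] c[OF a' x] by (intro module_diff_sums[OF smooth_rep_module[OF B]])
  show "std_diff G B 0 (E (r \<odot>\<^bsub>A\<^esub> a)) x = r \<odot>\<^bsub>B\<^esub> std_diff G B 0 (E a) x" for r
    unfolding d[OF a] d[OF rep_smult_closed[OF smooth_rep_module[OF A] a]] G_hom_std_resD(3)[OF E
        a t(1)[OF x]]
      G_hom_std_resD(3)[OF E a t(2)[OF x]]
    using c[OF a x] by (simp add: module_smult_diff[OF smooth_rep_module[OF B]])
  fix g assume g: "g \<in> carrier G"
  let ?x = "\<lambda>k\<in>{..1}. inv\<^bsub>G\<^esub> g \<otimes>\<^bsub>G\<^esub> x k"
  have x': "?x \<in> gpow G 1"
    by (rule gpow_translate[OF G.is_group g x])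
  have tr: "(\<lambda>k\<in>{..0}. inv\<^bsub>G\<^esub> g \<otimes>\<^bsub>G\<^esub> tuple1 (x j) k) = tuple1 (?x j)" if "j \<le> 1" for j
    using that by (auto simp: tuple1_def)
  show "std_diff G B 0 (E (act A g a)) x = act B g (std_diff G B 0 (E a) ?x)"
    unfolding d[OF rep_act_closed[OF smooth_repD(1)[OF A] g a]] std_diff_0[OF smooth_rep_module[OF
        B] \<phi>[OF a] x']
      G_hom_std_resD(4)[OF E g a t(1)[OF x]] G_hom_std_resD(4)[OF E g a t(2)[OF x]]
      tr[OF le0] tr[OF order.refl]
    using c[OF a x'] by (simp add: lin_hom_diff_arg[OF rep_act_lin[OF smooth_repD(1)[OF B] g]
        smooth_rep_module[OF B] smooth_rep_module[OF B]])
qed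

text \<open>Both sides of the defining equation are extensional, so it can be replaced by equations
  in B at the points of \<open>gpow G 1\<close>.\<close>

lemma ext1_rel_iff:
  "(F, F') \<in> ext1_rel G T A B \<longleftrightarrow> F \<in> ext1_cocycles G T A B \<and> F' \<in> ext1_cocycles G T A B \<and>
     (\<exists>E\<in>G_hom G A (std_res G T B 0). \<forall>a\<in>carrier A. \<forall>x\<in>gpow G 1.
        F' a x = F a x \<oplus>\<^bsub>B\<^esub> std_diff G B 0 (E a) x)"
proof -
  have "F' a = F a \<oplus>\<^bsub>std_res G T B 1\<^esub> std_diff G B 0 (E a) \<longleftrightarrow>
      (\<forall>x\<in>gpow G 1. F' a x = F a x \<oplus>\<^bsub>B\<^esub> std_diff G B 0 (E a) x)"
    if "F' \<in> ext1_cocycles G T A B" "a \<in> carrier A" for a and E :: "'a \<Rightarrow> (nat \<Rightarrow> 'g) \<Rightarrow> 'b"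
  proof -
    have "F' a \<in> extensional (gpow G 1)"
      using that std_resD(1)[OF G_hom_std_resD(1)[of F' G A T B 1 a]] by (auto simp:
          ext1_cocycles_def PiE_def)
    then show ?thesis
      by (auto simp: std_res_simps intro!: extensionalityI[of _ "gpow G 1"])
  qed
  then show ?thesis
    by (auto simp: ext1_rel_def)
qed

lemma ext1_rel_equiv: "equiv (ext1_cocycles G T A B) (ext1_rel G T A B)"
proof (rule equiv_if_euclidean)
  have cl: "F a x \<in> carrier B" if "F \<in> G_hom G A (std_res G T B i)" "a \<in> carrier A" "x \<in> gpow G i"
      for F a x i
    using std_resD(2)[OF G_hom_std_resD(1)[OF that(1,2)]] that(3) by auto
  have d0: "std_diff G B 0 (\<lambda>x\<in>gpow G 0. \<zero>\<^bsub>B\<^esub>) x = \<zero>\<^bsub>B\<^esub>" if "x \<in> gpow G 1" for x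
    using gpow_nth[OF that]
    by (subst std_diff_0[OF smooth_rep_module[OF B] _ that]) (auto simp: tuple1_in_gpow a_minus_def)
  show "(F, F) \<in> ext1_rel G T A B" if F: "F \<in> ext1_cocycles G T A B" for F
  proof -
    have "F \<in> G_hom G A (std_res G T B 1)"
      using F by (simp add: ext1_cocycles_def)
    then have "\<forall>a\<in>carrier A. \<forall>x\<in>gpow G 1. F a x = F a x \<oplus>\<^bsub>B\<^esub> std_diff G B 0 (\<lambda>x\<in>gpow G 0. \<zero>\<^bsub>B\<^esub>) x"
      using cl d0 by simp
    then show ?thesis
      unfolding ext1_rel_iff using F
      by (intro conjI bexI[of _ "\<lambda>a. \<lambda>x\<in>gpow G 0. \<zero>\<^bsub>B\<^esub>"] G_hom_std_res_zero)
  qed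
  fix F F1 F2 assume "(F, F1) \<in> ext1_rel G T A B" "(F, F2) \<in> ext1_rel G T A B"
  then obtain E1 E2 where F: "F \<in> ext1_cocycles G T A B" "F1 \<in> ext1_cocycles G T A B" "F2 \<in>
      ext1_cocycles G T A B"
    and E: "E1 \<in> G_hom G A (std_res G T B 0)" "E2 \<in> G_hom G A (std_res G T B 0)"
    and eq: "\<forall>a\<in>carrier A. \<forall>x\<in>gpow G 1. F1 a x = F a x \<oplus>\<^bsub>B\<^esub> std_diff G B 0 (E1 a) x"
      "\<forall>a\<in>carrier A. \<forall>x\<in>gpow G 1. F2 a x = F a x \<oplus>\<^bsub>B\<^esub> std_diff G B 0 (E2 a) x"
    unfolding ext1_rel_iff by blast
  have "F2 a x = F1 a x \<oplus>\<^bsub>B\<^esub> std_diff G B 0 (\<lambda>y\<in>gpow G 0. E2 a y \<ominus>\<^bsub>B\<^esub> E1 a y) x"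
    if a: "a \<in> carrier A" and x: "x \<in> gpow G 1" for a x
  proof -
    have "F a x \<in> carrier B"
      using F(1) a x cl by (auto simp: ext1_cocycles_def)
    then show ?thesis
      unfolding eq(1)[rule_format, OF a x] eq(2)[rule_format, OF a x]
        std_diff_0_diff[OF smooth_rep_module[OF B] std_resD(2)[OF G_hom_std_resD(1)[OF E(2) a]]
          std_resD(2)[OF G_hom_std_resD(1)[OF E(1) a]] x]
      using cl[OF G_hom_std_diff_0[OF E(1)] a x] cl[OF G_hom_std_diff_0[OF E(2)] a x]
      by (intro module_add_via[OF smooth_rep_module[OF B]])
  qed
  then show "(F1, F2) \<in> ext1_rel G T A B"
    unfolding ext1_rel_iff using F
    by (intro conjI bexI[of _ "\<lambda>a. \<lambda>y\<in>gpow G 0. E2 a y \<ominus>\<^bsub>B\<^esub> E1 a y"] ballI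
        G_hom_std_res_diff[OF E(2,1)])
next
  show "ext1_rel G T A B \<subseteq> ext1_cocycles G T A B \<times> ext1_cocycles G T A B"
    unfolding ext1_rel_def by blast
qed

text \<open>The passage from homogeneous to inhomogeneous cochains. Closedness at the point (1, g,
  gh) says F(a)(g, gh) + F(a)(1, g) = F(a)(1, gh), and equivariance rewrites the first term as g
  F(g^-1 a)(1, h).\<close>

lemma ext1_cocycle_at_one:
  assumes F: "F \<in> ext1_cocycles G T A B"
  shows "(\<lambda>g a. F a (tuple2 \<one>\<^bsub>G\<^esub> g)) \<in> cocycles1 G T A B"
  unfolding cocycles1_def
proof (intro CollectI conjI ballI)
  have F': "F \<in> G_hom G A (std_res G T B 1)"
    and dF: "\<And>a. a \<in> carrier A \<Longrightarrow> std_diff G B 1 (F a) = \<zero>\<^bsub>std_res G T B 2\<^esub>"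
    using F by (auto simp: ext1_cocycles_def)
  have \<phi>: "F a \<in> gpow G 1 \<rightarrow> carrier B" if "a \<in> carrier A" for a
    using std_resD(2)[OF G_hom_std_resD(1)[OF F' that]] .
  have t: "tuple2 \<one>\<^bsub>G\<^esub> g \<in> gpow G 1" if "g \<in> carrier G" for g
    using that by (intro tuple2_in_gpow) auto
  show "(\<lambda>a. F a (tuple2 \<one>\<^bsub>G\<^esub> g)) \<in> lin_hom A B" if "g \<in> carrier G" for g
    using \<phi> t[OF that] G_hom_std_resD(2)[OF F' _ _ t[OF that]] G_hom_std_resD(3)[OF F' _ t[OF that]]
    by (auto simp: lin_hom_def Pi_iff)
  show "locally_constant T (\<lambda>g. F a (tuple2 \<one>\<^bsub>G\<^esub> g))" if "a \<in> carrier A" for a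
    using std_resD(3)[OF G_hom_std_resD(1)[OF F' that]]
    by (rule locally_constant_compose) (simp add: continuous_map_tuple2[unfolded One_nat_def]
        l_groupD(2)[OF G])
  fix g h a assume g: "g \<in> carrier G" and h: "h \<in> carrier G" and a: "a \<in> carrier A"
  let ?a = "act A (inv\<^bsub>G\<^esub> g) a" and ?gh = "g \<otimes>\<^bsub>G\<^esub> h"
  have gh: "?gh \<in> carrier G" and a': "?a \<in> carrier A"
    using g h a rep_act_closed[OF smooth_repD(1)[OF A]] by auto
  have "(\<lambda>k\<in>{..1}. inv\<^bsub>G\<^esub> g \<otimes>\<^bsub>G\<^esub> tuple2 g ?gh k) = tuple2 \<one>\<^bsub>G\<^esub> h"
    using g h by (auto simp: tuple2_def G.m_assoc[symmetric])
  then have eq: "F a (tuple2 g ?gh) = act B g (F ?a (tuple2 \<one>\<^bsub>G\<^esub> h))"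
    using G_hom_std_resD(4)[OF F' g a' tuple2_in_gpow[OF g gh]] rep_act_act_inv[OF G.is_group
        smooth_repD(1)[OF A] g a] by simp
  define x where "x = (\<lambda>k\<in>{..2::nat}. if k = 0 then \<one>\<^bsub>G\<^esub> else if k = 1 then g else ?gh)"
  have x: "x \<in> gpow G 2" "x 0 = \<one>\<^bsub>G\<^esub>" "x 1 = g" "x 2 = ?gh"
    using g gh by (auto simp: x_def gpow_def)
  have c: "F a (tuple2 g ?gh) \<in> carrier B" "F a (tuple2 \<one>\<^bsub>G\<^esub> g) \<in> carrier B" "F a (tuple2 \<one>\<^bsub>G\<^esub>
      ?gh) \<in> carrier B"
    using \<phi>[OF a] t[OF g] t[OF gh] tuple2_in_gpow[OF g gh] by auto
  have "(F a (tuple2 g ?gh) \<oplus>\<^bsub>B\<^esub> F a (tuple2 \<one>\<^bsub>G\<^esub> g)) \<ominus>\<^bsub>B\<^esub> F a (tuple2 \<one>\<^bsub>G\<^esub> ?gh) = \<zero>\<^bsub>B\<^esub>"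
    using std_diff_1[OF smooth_rep_module[OF B] \<phi>[OF a] x(1)] dF[OF a] x by (simp add: std_res_simps)
  then have "F a (tuple2 g ?gh) \<oplus>\<^bsub>B\<^esub> F a (tuple2 \<one>\<^bsub>G\<^esub> g) = \<zero>\<^bsub>B\<^esub> \<oplus>\<^bsub>B\<^esub> F a (tuple2 \<one>\<^bsub>G\<^esub> ?gh)"
    using c by (subst rep_add_eq_iff_diff[OF smooth_rep_module[OF B]]) auto
  then show "F a (tuple2 \<one>\<^bsub>G\<^esub> ?gh) = act B g (F ?a (tuple2 \<one>\<^bsub>G\<^esub> h)) \<oplus>\<^bsub>B\<^esub> F a (tuple2 \<one>\<^bsub>G\<^esub> g)"
    using c by (simp add: eq)
qed

text \<open>If E gives the homogeneous coboundary, then \<eta>(a) = E(a)(1) gives the inhomogeneous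
  one: equivariance yields E(a)(g) = g \<eta>(g^-1 a), so the differential of E(a) at (1, g) is g
  \<eta>(g^-1 a) - \<eta>(a).\<close>

lemma ext1_rel_imp_coh1_rel:
  assumes "(F, F') \<in> ext1_rel G T A B"
  shows "(\<lambda>g a. F a (tuple2 \<one>\<^bsub>G\<^esub> g), \<lambda>g a. F' a (tuple2 \<one>\<^bsub>G\<^esub> g)) \<in> coh1_rel G T A B"
proof -
  obtain E where F: "F \<in> ext1_cocycles G T A B" "F' \<in> ext1_cocycles G T A B"
    and E: "E \<in> G_hom G A (std_res G T B 0)"
    and eq: "\<forall>a\<in>carrier A. \<forall>x\<in>gpow G 1. F' a x = F a x \<oplus>\<^bsub>B\<^esub> std_diff G B 0 (E a) x"
    using assms unfolding ext1_rel_iff by blast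
  have \<phi>: "E a \<in> gpow G 0 \<rightarrow> carrier B" if "a \<in> carrier A" for a
    using std_resD(2)[OF G_hom_std_resD(1)[OF E that]] .
  define \<eta> where "\<eta> = (\<lambda>a. E a (tuple1 \<one>\<^bsub>G\<^esub>))"
  have one: "tuple1 \<one>\<^bsub>G\<^esub> \<in> gpow G 0"
    by (rule tuple1_in_gpow) simp
  have "\<eta> \<in> lin_hom A B"
    using \<phi> one G_hom_std_resD(2)[OF E _ _ one] G_hom_std_resD(3)[OF E _ one]
    by (auto simp: lin_hom_def \<eta>_def Pi_iff)
  moreover have "F' a (tuple2 \<one>\<^bsub>G\<^esub> g) = F a (tuple2 \<one>\<^bsub>G\<^esub> g) \<oplus>\<^bsub>B\<^esub> coboundary1 G A B \<eta> g a"
    if g: "g \<in> carrier G" and a: "a \<in> carrier A" for g a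
  proof -
    let ?a = "act A (inv\<^bsub>G\<^esub> g) a"
    have a': "?a \<in> carrier A"
      using g a rep_act_closed[OF smooth_repD(1)[OF A]] by auto
    have t: "tuple2 \<one>\<^bsub>G\<^esub> g \<in> gpow G 1"
      using g by (intro tuple2_in_gpow) auto
    have "(\<lambda>k\<in>{..0}. inv\<^bsub>G\<^esub> g \<otimes>\<^bsub>G\<^esub> tuple1 g k) = tuple1 \<one>\<^bsub>G\<^esub>"
      using g by (auto simp: tuple1_def)
    then have "E a (tuple1 g) = act B g (\<eta> ?a)"
      using G_hom_std_resD(4)[OF E g a' tuple1_in_gpow[OF g]] rep_act_act_inv[OF G.is_group
          smooth_repD(1)[OF A] g a]
      by (simp add: \<eta>_def)
    then show ?thesis
      using eq[rule_format, OF a t] std_diff_0[OF smooth_rep_module[OF B] \<phi>[OF a] t] by (simp add: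
          coboundary1_def \<eta>_def)
  qed
  ultimately show ?thesis
    unfolding coh1_rel_iff using ext1_cocycle_at_one[OF F(1)] ext1_cocycle_at_one[OF F(2)] by blast
qed

text \<open>Representatives of one Ext class give cohomologous 1-cocycles, so the union in
  \<open>ext1_ident\<close> runs over equal sets; it is nonempty because F itself is a
  representative.\<close>

lemma ext1_ident_class:
  assumes F: "F \<in> ext1_cocycles G T A B"
  shows "ext1_ident G T A B (ext1_rel G T A B `` {F}) =
    coh1_class G T A B (\<lambda>g a. F a (tuple2 \<one>\<^bsub>G\<^esub> g))"
proof -
  have "coh1_class G T A B (\<lambda>g a. F' a (tuple2 \<one>\<^bsub>G\<^esub> g)) = coh1_class G T A B (\<lambda>g a. F a (tuple2
      \<one>\<^bsub>G\<^esub> g))"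
    if "F' \<in> ext1_rel G T A B `` {F}" for F'
    unfolding coh1_class_def
    using equiv_class_eq[OF coh1_rel_equiv ext1_rel_imp_coh1_rel[of F F']] that by simp
  moreover have "F \<in> ext1_rel G T A B `` {F}"
    using equiv_class_self[OF ext1_rel_equiv F] .
  ultimately show ?thesis
    unfolding ext1_ident_def tuple2_def[symmetric] by blast
qed

end

text \<open>Identifying the residue cocycle with a coboundary is possible only on the carriers; this
  carries the cocycle property across.\<close>

lemma cocycles1_cong:
  assumes "l_group G T" and A: "module complex_field (A :: ('g, 'a) rep)" and \<psi>: "\<psi> \<in> cocycles1 G T A B"
    and rep: "representation G A"
    and eq: "\<And>g a. g \<in> carrier G \<Longrightarrow> a \<in> carrier A \<Longrightarrow> \<psi>' g a = \<psi> g a"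
  shows "\<psi>' \<in> cocycles1 G T A B"
  unfolding cocycles1_def
proof (intro CollectI conjI ballI)
  interpret G: group G
    using assms(1) by (rule l_groupD)
  interpret A: module complex_field A
    by (rule A)
  show "\<psi>' g \<in> lin_hom A B" if g: "g \<in> carrier G" for g
  proof -
    have "\<psi> g \<in> lin_hom A B"
      using \<psi> g by (simp add: cocycles1_def)
    then show ?thesis
      using eq[OF g] by (auto simp: lin_hom_def Pi_iff)
  qed
  show "locally_constant T (\<lambda>g. \<psi>' g a)" if a: "a \<in> carrier A" for a
    using \<psi> a eq[OF _ a] locally_constant_cong[of T "\<lambda>g. \<psi>' g a" "\<lambda>g. \<psi> g a"]
    by (simp add: cocycles1_def l_groupD(2)[OF assms(1)])
  show "\<psi>' (g \<otimes>\<^bsub>G\<^esub> h) a = act B g (\<psi>' h (act A (inv\<^bsub>G\<^esub> g) a)) \<oplus>\<^bsub>B\<^esub> \<psi>' g a"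
    if "g \<in> carrier G" "h \<in> carrier G" "a \<in> carrier A" for g h a
    using \<psi> that eq rep_act_closed[OF rep, of "inv\<^bsub>G\<^esub> g" a] by (simp add: cocycles1_def)
qed

section \<open>The connecting homomorphism\<close>

context
  fixes G :: "('g, 'm) monoid_scheme" and T :: "'g topology"
    and V :: "('g, 'v) rep" and W :: "('g, 'w) rep" and U :: "'v set"
  assumes G: "l_group G T" and V: "smooth_rep G T V" and W: "smooth_rep G T W"
    and U: "is_subrep G V U"
begin

interpretation G: group G
  using G by (rule l_groupD)

interpretation V: module complex_field V
  by (rule smooth_rep_module[OF V])

interpretation W: module complex_field W
  by (rule smooth_rep_module[OF W])

private lemmas smooth_quot = smooth_rep_quot[OF G.is_group smooth_repD(1)[OF V] U V]
private lemmas quot_eq = quot_carrier[OF G.is_group smooth_repD(1)[OF V] U]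
private lemmas U_subset = subrep_subset[OF G.is_group smooth_repD(1)[OF V] U]

text \<open>Frobenius reciprocity: a linear map is recovered from this G-map by evaluation at 1.
  Equivariance rests on x^-1 (g v) = (g^-1 x)^-1 v, which turns E(g v)(x) into g E(v)(g^-1
  x).\<close>

lemma std_res_extension:
  assumes \<eta>: "\<eta> \<in> lin_hom V W"
  shows "(\<lambda>v. \<lambda>x\<in>gpow G 0. act W (x 0) (\<eta> (act V (inv\<^bsub>G\<^esub> (x 0)) v))) \<in> G_hom G V (std_res G T W 0)"
    (is "?E \<in> _")
proof (rule G_hom_std_resI[OF V smooth_repD(1)[OF W]])
  note cV = rep_act_closed[OF smooth_repD(1)[OF V]] and cW = rep_act_closed[OF smooth_repD(1)[OF
      W]] and c\<eta> = lin_hom_closed[OF \<eta>]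
  fix v assume v: "v \<in> carrier V"
  have n: "x 0 \<in> carrier G" if "x \<in> gpow G 0" for x
    using gpow_nth[OF that] by simp
  show "?E v \<in> gpow G 0 \<rightarrow>\<^sub>E carrier W"
    using v n by (auto intro!: cW c\<eta> cV)
  show "locally_constant (product_topology (\<lambda>_. T) {..0}) (?E v)"
    unfolding locally_constant_restrict_gpow[OF G]
    by (rule locally_constant_compose[OF locally_constant_conjugate[OF G V W c\<eta> v]])
      (auto intro!: continuous_map_product_projection simp del: atMost_0)
  fix x assume x: "x \<in> gpow G 0"
  note lin = lin_homD(2,3)[OF rep_act_lin[OF smooth_repD(1)[OF W] n[OF x]]] lin_homD(2,3)[OF \<eta>]
    lin_homD(2,3)[OF rep_act_lin[OF smooth_repD(1)[OF V] G.inv_closed[OF n[OF x]]]]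
  show "?E (v \<oplus>\<^bsub>V\<^esub> v') x = ?E v x \<oplus>\<^bsub>W\<^esub> ?E v' x" if "v' \<in> carrier V" for v'
    using v that x n[OF x] by (simp add: lin cV c\<eta>)
  show "?E (r \<odot>\<^bsub>V\<^esub> v) x = r \<odot>\<^bsub>W\<^esub> ?E v x" for r
    using v x n[OF x] by (simp add: lin cV c\<eta>)
  fix g assume g: "g \<in> carrier G"
  let ?x = "\<lambda>k\<in>{..0}. inv\<^bsub>G\<^esub> g \<otimes>\<^bsub>G\<^esub> x k"
  have x': "?x \<in> gpow G 0"
    by (rule gpow_translate[OF G.is_group g x])
  have "inv\<^bsub>G\<^esub> (inv\<^bsub>G\<^esub> g \<otimes>\<^bsub>G\<^esub> x 0) = inv\<^bsub>G\<^esub> (x 0) \<otimes>\<^bsub>G\<^esub> g"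
    using g n[OF x] by (simp add: G.inv_mult_group)
  then show "?E (act V g v) x = act W g (?E v ?x)"
    using x x' g v n[OF x] rep_act_mult[OF smooth_repD(1)[OF V], of "inv\<^bsub>G\<^esub> (x 0)" g v]
      rep_act_mult[OF smooth_repD(1)[OF W] g, of "inv\<^bsub>G\<^esub> g \<otimes>\<^bsub>G\<^esub> x 0" "\<eta> (act V (inv\<^bsub>G\<^esub> (x 0)) (act
          V g v))"]
    by (simp add: cV c\<eta> G.m_assoc[symmetric])
qed

lemma std_diff_extension:
  assumes \<eta>: "\<eta> \<in> lin_hom V W" and g: "g \<in> carrier G" and v: "v \<in> carrier V"
  shows "std_diff G W 0 (\<lambda>x\<in>gpow G 0. act W (x 0) (\<eta> (act V (inv\<^bsub>G\<^esub> (x 0)) v))) (tuple2 \<one>\<^bsub>G\<^esub> g) =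
    coboundary1 G V W \<eta> g v"
proof -
  have t: "tuple2 \<one>\<^bsub>G\<^esub> g \<in> gpow G 1"
    using g by (intro tuple2_in_gpow) auto
  show ?thesis
    using g v std_resD(2)[OF G_hom_std_resD(1)[OF std_res_extension[OF \<eta>] v]]
    by (subst std_diff_0[OF smooth_rep_module[OF W] _ t])
      (auto simp: tuple1_in_gpow coboundary1_def rep_act_one[OF smooth_repD(1)[OF V]]
          rep_act_one[OF smooth_repD(1)[OF W]] lin_hom_closed[OF \<eta>])
qed

context
  fixes E f
  assumes E: "E \<in> G_hom G V (std_res G T W 0)" and Ef: "\<And>u. u \<in> U \<Longrightarrow> E u = std_aug G (f u)"
begin

private lemma E_funcset: "v \<in> carrier V \<Longrightarrow> E v \<in> gpow G 0 \<rightarrow> carrier W"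
  by (rule std_resD(2)[OF G_hom_std_resD(1)[OF E]])

text \<open>For u in U the function \<open>E u\<close> is constant, so its differential is zero and
  the differential of \<open>E v\<close> depends only on the coset of v. The descended map is closed
  because two consecutive differentials compose to zero.\<close>

lemma snake_cocycle_exists:
  "\<exists>F\<in>ext1_cocycles G T (quot_rep V U) W. \<forall>v\<in>carrier V. F (U +>\<^bsub>V\<^esub> v) = std_diff G W 0 (E v)"
proof -
  have "std_diff G W 0 (E (u \<oplus>\<^bsub>V\<^esub> v)) x = std_diff G W 0 (E v) x"
    if u: "u \<in> U" and v: "v \<in> carrier V" and x: "x \<in> gpow G 1" for u v x
  proof -
    have uV: "u \<in> carrier V"
      using u U_subset by auto
    have t: "tuple1 (x 0) \<in> gpow G 0" "tuple1 (x 1) \<in> gpow G 0"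
      using gpow_nth[OF x] by (auto intro: tuple1_in_gpow)
    have c: "E u (tuple1 (x 0)) \<in> carrier W" "E v (tuple1 (x 0)) \<in> carrier W"
      "E u (tuple1 (x 1)) \<in> carrier W" "E v (tuple1 (x 1)) \<in> carrier W"
      using E_funcset[OF uV] E_funcset[OF v] t by auto
    have "E u (tuple1 (x 1)) = E u (tuple1 (x 0))"
      using Ef[OF u] t by (simp add: std_aug_def)
    then have "E u (tuple1 (x 1)) \<ominus>\<^bsub>W\<^esub> E u (tuple1 (x 0)) = \<zero>\<^bsub>W\<^esub>"
      using c by (simp add: a_minus_def W.M.r_neg)
    then show ?thesis
      unfolding std_diff_0[OF smooth_rep_module[OF W] E_funcset[OF v] x]
        std_diff_0[OF smooth_rep_module[OF W] E_funcset[OF V.M.a_closed[OF uV v]] x]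
        G_hom_std_resD(2)[OF E uV v t(1)] G_hom_std_resD(2)[OF E uV v t(2)]
        module_diff_sums[OF smooth_rep_module[OF W] c(3,4,1,2)]
      using c by simp
  qed
  then have "std_diff G W 0 (E (u \<oplus>\<^bsub>V\<^esub> v)) = std_diff G W 0 (E v)" if "u \<in> U" "v \<in> carrier V" for u v
    using that by (intro extensionalityI[of _ "gpow G 1"]) (auto simp: std_diff_def)
  from G_hom_quot[OF G.is_group smooth_repD(1)[OF V] U G_hom_std_diff_0[OF G V W E] this]
  obtain F where F: "F \<in> G_hom G (quot_rep V U) (std_res G T W 1)"
    "\<forall>v\<in>carrier V. F (U +>\<^bsub>V\<^esub> v) = std_diff G W 0 (E v)"
    by blast
  have "std_diff G W 1 (F y) = \<zero>\<^bsub>std_res G T W 2\<^esub>" if "y \<in> carrier (quot_rep V U)" for y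
    using that F(2) std_diff_std_diff[OF smooth_rep_module[OF W] E_funcset] by (auto simp: quot_eq)
  with F show ?thesis
    by (auto simp: ext1_cocycles_def)
qed

text \<open>Independence of the extension, as the definite description demands. Two extensions of f
  agree on U, so their difference descends to a G-map from V/U to I^0, whose differential is the
  difference of the two cocycles.\<close>

lemma connecting_hom_eq:
  assumes F: "F \<in> ext1_cocycles G T (quot_rep V U) W"
    and FE: "\<And>v. v \<in> carrier V \<Longrightarrow> F (U +>\<^bsub>V\<^esub> v) = std_diff G W 0 (E v)"
  shows "connecting_hom G T V U W f = ext1_rel G T (quot_rep V U) W `` {F}"
  unfolding connecting_hom_def
proof (rule the_equality)
  let ?r = "ext1_rel G T (quot_rep V U) W"
  note eqv = ext1_rel_equiv[OF G smooth_quot W]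
  show "?r `` {F} \<in> ext1 G T (quot_rep V U) W \<and>
      (\<exists>E\<in>G_hom G V (std_res G T W 0). \<exists>F\<in>?r `` {F}.
        (\<forall>u\<in>U. E u = std_aug G (f u)) \<and> (\<forall>v\<in>carrier V. F (U +>\<^bsub>V\<^esub> v) = std_diff G W 0 (E v)))"
    using E Ef FE equiv_class_self[OF eqv F] quotientI[OF F] unfolding ext1_def by blast
  fix Y assume "Y \<in> ext1 G T (quot_rep V U) W \<and>
      (\<exists>E\<in>G_hom G V (std_res G T W 0). \<exists>F\<in>Y.
        (\<forall>u\<in>U. E u = std_aug G (f u)) \<and> (\<forall>v\<in>carrier V. F (U +>\<^bsub>V\<^esub> v) = std_diff G W 0 (E v)))"
  then obtain E' F' where Y: "Y \<in> ext1_cocycles G T (quot_rep V U) W // ?r"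
    and E': "E' \<in> G_hom G V (std_res G T W 0)" "\<And>u. u \<in> U \<Longrightarrow> E' u = std_aug G (f u)"
    and F': "F' \<in> Y" "\<And>v. v \<in> carrier V \<Longrightarrow> F' (U +>\<^bsub>V\<^esub> v) = std_diff G W 0 (E' v)"
    unfolding ext1_def by blast
  have F'c: "F' \<in> ext1_cocycles G T (quot_rep V U) W"
    using in_quotient_imp_subset[OF eqv Y] F'(1) by blast
  have E'_funcset: "E' v \<in> gpow G 0 \<rightarrow> carrier W" if "v \<in> carrier V" for v
    using that by (rule std_resD(2)[OF G_hom_std_resD(1)[OF E'(1)]])
  let ?D = "\<lambda>v. \<lambda>x\<in>gpow G 0. E v x \<ominus>\<^bsub>W\<^esub> E' v x"
  have "?D (u \<oplus>\<^bsub>V\<^esub> v) = ?D v" if u: "u \<in> U" and v: "v \<in> carrier V" for u v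
  proof (rule restrict_ext)
    fix x assume x: "x \<in> gpow G 0"
    have uV: "u \<in> carrier V"
      using u U_subset by auto
    have c: "E u x \<in> carrier W" "E v x \<in> carrier W" "E' u x \<in> carrier W" "E' v x \<in> carrier W"
      using E_funcset[OF uV] E_funcset[OF v] E'_funcset[OF uV] E'_funcset[OF v] x by auto
    have "E u x \<ominus>\<^bsub>W\<^esub> E' u x = \<zero>\<^bsub>W\<^esub>"
      using c by (simp add: Ef[OF u] E'(2)[OF u] a_minus_def W.M.r_neg)
    then show "E (u \<oplus>\<^bsub>V\<^esub> v) x \<ominus>\<^bsub>W\<^esub> E' (u \<oplus>\<^bsub>V\<^esub> v) x = E v x \<ominus>\<^bsub>W\<^esub> E' v x"
      unfolding G_hom_std_resD(2)[OF E uV v x] G_hom_std_resD(2)[OF E'(1) uV v x]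
        module_diff_sums[OF smooth_rep_module[OF W] c]
      using c by simp
  qed
  from G_hom_quot[OF G.is_group smooth_repD(1)[OF V] U G_hom_std_res_diff[OF G V W E E'(1)] this]
  obtain D' where D': "D' \<in> G_hom G (quot_rep V U) (std_res G T W 0)"
    "\<forall>v\<in>carrier V. D' (U +>\<^bsub>V\<^esub> v) = ?D v"
    by blast
  have "F y x = F' y x \<oplus>\<^bsub>W\<^esub> std_diff G W 0 (D' y) x"
    if y: "y \<in> carrier (quot_rep V U)" and x: "x \<in> gpow G 1" for y x
  proof -
    obtain v where v: "y = U +>\<^bsub>V\<^esub> v" "v \<in> carrier V"
      using y by (auto simp: quot_eq)
    have c: "std_diff G W 0 (E v) x \<in> carrier W" "std_diff G W 0 (E' v) x \<in> carrier W"
      using std_resD(2)[OF G_hom_std_resD(1)[OF G_hom_std_diff_0[OF G V W E] v(2)]]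
        std_resD(2)[OF G_hom_std_resD(1)[OF G_hom_std_diff_0[OF G V W E'(1)] v(2)]] x by auto
    have "F y x = std_diff G W 0 (E v) x" "F' y x = std_diff G W 0 (E' v) x"
      using FE F'(2) v by auto
    moreover have "std_diff G W 0 (D' y) x = std_diff G W 0 (E v) x \<ominus>\<^bsub>W\<^esub> std_diff G W 0 (E' v) x"
      using D'(2) v std_diff_0_diff[OF smooth_rep_module[OF W] E_funcset[OF v(2)] E'_funcset[OF
          v(2)] x] by simp
    ultimately show ?thesis
      \<comment> \<open>\<open>module_add_via\<close> with x = 0 inserts the differential of
        \<open>E' v\<close> and cancels it again.\<close>
      using c module_add_via[OF smooth_rep_module[OF W] W.M.zero_closed c] by simp
  qed
  then have "(F', F) \<in> ?r"
    unfolding ext1_rel_iff[OF G smooth_quot W] using F F'c D'(1) by blast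
  then show "Y = ?r `` {F}"
    using quotient_eqI[OF eqv Y quotientI[OF F] F'(1) equiv_class_self[OF eqv F]] by blast
qed

end

end

section \<open>Residues of intertwining operators\<close>

lemma vec_holomorphic_at_closed:
  assumes W: "module complex_field W" and f: "vec_holomorphic_at W f z"
  shows "f z \<in> carrier W"
proof -
  obtain a where "has_vec_laurent W f z a" "a 0 = f z"
    using vec_holomorphic_at_has_vec_laurent[OF W f] .
  then show ?thesis
    using has_vec_laurent_closed[OF W, of f z a 0] by simp
qed

lemma meromorphic_intertwinerD:
  assumes "meromorphic_intertwiner G T V W D \<omega> \<xi>" and "s \<in> D"
  shows "\<lbrakk>g \<in> carrier G; v \<in> carrier V; vec_holomorphic_at W (\<lambda>s'. \<xi> s' v) s;
      vec_holomorphic_at W (\<lambda>s'. \<xi> s' (act V g v)) s\<rbrakk> \<Longrightarrow>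
      act W g (\<xi> s v) = \<omega> s g \<odot>\<^bsub>W\<^esub> \<xi> s (act V g v)"
    and "\<lbrakk>v \<in> carrier V; v' \<in> carrier V; vec_holomorphic_at W (\<lambda>s'. \<xi> s' v) s;
      vec_holomorphic_at W (\<lambda>s'. \<xi> s' v') s; vec_holomorphic_at W (\<lambda>s'. \<xi> s' (v \<oplus>\<^bsub>V\<^esub> v')) s\<rbrakk> \<Longrightarrow>
      \<xi> s (v \<oplus>\<^bsub>V\<^esub> v') = \<xi> s v \<oplus>\<^bsub>W\<^esub> \<xi> s v'"
    and "\<lbrakk>v \<in> carrier V; vec_holomorphic_at W (\<lambda>s'. \<xi> s' v) s;
      vec_holomorphic_at W (\<lambda>s'. \<xi> s' (a \<odot>\<^bsub>V\<^esub> v)) s\<rbrakk> \<Longrightarrow>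
      \<xi> s (a \<odot>\<^bsub>V\<^esub> v) = a \<odot>\<^bsub>W\<^esub> \<xi> s v"
    and "v \<in> carrier V \<Longrightarrow> \<exists>K. vec_meromorphic_on W (fixed_vectors W K) (\<lambda>s. \<xi> s v) D"
  using assms unfolding meromorphic_intertwiner_def Let_def by blast+

context
  fixes G :: "('g, 'm) monoid_scheme" and T :: "'g topology"
    and D :: "complex set" and \<omega> :: "complex \<Rightarrow> 'g \<Rightarrow> complex"
    and V :: "('g, 'v) rep" and W :: "('g, 'w) rep"
    and \<xi> :: "complex \<Rightarrow> 'v \<Rightarrow> 'w" and s\<^sub>0 :: complex
  assumes G: "l_group G T" and D: "open D" and \<omega>: "holomorphic_character G T D \<omega>"
    and V: "smooth_rep G T V" and W: "smooth_rep G T W"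
    and \<xi>: "meromorphic_intertwiner G T V W D \<omega> \<xi>" and s\<^sub>0: "s\<^sub>0 \<in> D"
begin

interpretation G: group G
  using G by (rule l_groupD)

interpretation V: module complex_field V
  by (rule smooth_rep_module[OF V])

interpretation W: module complex_field W
  by (rule smooth_rep_module[OF W])

lemma
  assumes v: "v \<in> carrier V"
  shows intertwiner_has_vec_laurent:
      "has_vec_laurent W (\<lambda>s. \<xi> s v) s\<^sub>0 (laurent_coeff W (\<lambda>s. \<xi> s v) s\<^sub>0)"
    and intertwiner_holomorphic:
      "\<forall>\<^sub>F s in at s\<^sub>0. s \<in> D \<and> vec_holomorphic_at W (\<lambda>s'. \<xi> s' v) s"
proof -
  obtain K where "vec_meromorphic_on W (fixed_vectors W K) (\<lambda>s. \<xi> s v) D"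
    using meromorphic_intertwinerD(4)[OF \<xi> s\<^sub>0 v] by blast
  moreover have "fixed_vectors W K \<subseteq> carrier W"
    by (auto simp: fixed_vectors_def)
  ultimately have "\<exists>a. has_vec_laurent W (\<lambda>s. \<xi> s v) s\<^sub>0 a"
    and ev: "\<forall>\<^sub>F s in at s\<^sub>0. vec_holomorphic_at W (\<lambda>s'. \<xi> s' v) s"
    using vec_meromorphic_onD[OF smooth_rep_module[OF W] _ _ D s\<^sub>0] by blast+
  then show "has_vec_laurent W (\<lambda>s. \<xi> s v) s\<^sub>0 (laurent_coeff W (\<lambda>s. \<xi> s v) s\<^sub>0)"
    using laurent_coeff_eq[OF smooth_rep_module[OF W]] by metis
  show "\<forall>\<^sub>F s in at s\<^sub>0. s \<in> D \<and> vec_holomorphic_at W (\<lambda>s'. \<xi> s' v) s"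
    using ev eventually_at_in_open'[OF D s\<^sub>0] by eventually_elim simp
qed

text \<open>On one punctured neighbourhood of \<open>s\<^sub>0\<close> all three vectors have
  holomorphic families, so additivity of \<xi> holds there and passes to the coefficients by
  uniqueness.\<close>

lemma intertwiner_laurent_coeff_add:
  assumes v: "v \<in> carrier V" "v' \<in> carrier V"
  shows "laurent_coeff W (\<lambda>s. \<xi> s (v \<oplus>\<^bsub>V\<^esub> v')) s\<^sub>0 =
    (\<lambda>k. laurent_coeff W (\<lambda>s. \<xi> s v) s\<^sub>0 k \<oplus>\<^bsub>W\<^esub> laurent_coeff W (\<lambda>s. \<xi> s v') s\<^sub>0 k)"
proof (rule laurent_coeff_eq[OF smooth_rep_module[OF W] has_vec_laurent_cong])
  show "\<forall>\<^sub>F s in at s\<^sub>0. \<xi> s v \<oplus>\<^bsub>W\<^esub> \<xi> s v' = \<xi> s (v \<oplus>\<^bsub>V\<^esub> v')"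
    using intertwiner_holomorphic[OF v(1)] intertwiner_holomorphic[OF v(2)]
      intertwiner_holomorphic[OF V.M.a_closed[OF v]]
    by eventually_elim (use meromorphic_intertwinerD(2)[OF \<xi> _ v] in simp)
qed (intro smooth_rep_module[OF W] has_vec_laurent_add[OF smooth_rep_module[OF W]]
    intertwiner_has_vec_laurent v)+

lemma intertwiner_laurent_coeff_smult:
  assumes v: "v \<in> carrier V"
  shows "laurent_coeff W (\<lambda>s. \<xi> s (r \<odot>\<^bsub>V\<^esub> v)) s\<^sub>0 = (\<lambda>k. r \<odot>\<^bsub>W\<^esub> laurent_coeff W (\<lambda>s. \<xi> s v) s\<^sub>0 k)"
proof (rule laurent_coeff_eq[OF smooth_rep_module[OF W] has_vec_laurent_cong])
  show "\<forall>\<^sub>F s in at s\<^sub>0. r \<odot>\<^bsub>W\<^esub> \<xi> s v = \<xi> s (r \<odot>\<^bsub>V\<^esub> v)"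
    using intertwiner_holomorphic[OF v] intertwiner_holomorphic[OF rep_smult_closed[OF
        smooth_rep_module[OF V] v, of r]]
    by eventually_elim (use meromorphic_intertwinerD(3)[OF \<xi> _ v] in simp)
qed (intro smooth_rep_module[OF W] has_vec_laurent_smult[OF smooth_rep_module[OF W]]
    intertwiner_has_vec_laurent v)+

lemma intertwiner_laurent_coeff_lin_hom:
  "(\<lambda>v. laurent_coeff W (\<lambda>s. \<xi> s v) s\<^sub>0 k) \<in> lin_hom V W"
  using has_vec_laurent_closed[OF smooth_rep_module[OF W] intertwiner_has_vec_laurent]
  by (simp add: lin_hom_def intertwiner_laurent_coeff_add intertwiner_laurent_coeff_smult)

lemma residue_cocycle_eq_coboundary1:
  assumes g: "g \<in> carrier G" and v: "v \<in> carrier V"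
  shows "residue_cocycle W \<omega> \<xi> s\<^sub>0 g v = coboundary1 G V W (\<lambda>v. laurent_coeff W (\<lambda>s. \<xi> s v) s\<^sub>0 0) g v"
proof -
  let ?v = "act V (inv\<^bsub>G\<^esub> g) v" and ?h = "\<lambda>s. (\<omega> s g - 1) / (s - s\<^sub>0)"
  define a where "a = laurent_coeff W (\<lambda>s. \<xi> s v) s\<^sub>0"
  define a' where "a' = laurent_coeff W (\<lambda>s. \<xi> s ?v) s\<^sub>0"
  have v': "?v \<in> carrier V"
    using g v by (intro rep_act_closed[OF smooth_repD(1)[OF V]]) auto
  have a: "has_vec_laurent W (\<lambda>s. \<xi> s v) s\<^sub>0 a" and a': "has_vec_laurent W (\<lambda>s. \<xi> s ?v) s\<^sub>0 a'"
    unfolding a_def a'_def by (rule intertwiner_has_vec_laurent[OF v]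
        intertwiner_has_vec_laurent[OF v'])+
  have "(\<lambda>s. \<omega> s g) holomorphic_on D"
    using \<omega> g by (simp add: holomorphic_character_def)
  then have "(\<lambda>s. \<omega> s g) analytic_on {s\<^sub>0}"
    using D s\<^sub>0 by (rule holomorphic_on_imp_analytic_at)
  then have "(\<lambda>t. \<omega> (s\<^sub>0 + t) g) has_laurent_expansion fps_to_fls (fps_expansion (\<lambda>s. \<omega> s g) s\<^sub>0)"
    by (intro has_laurent_expansion_fps analytic_at_imp_has_fps_expansion)
  then have "(\<lambda>t. (\<omega> (s\<^sub>0 + t) g - 1) / t) has_laurent_expansion
      (fps_to_fls (fps_expansion (\<lambda>s. \<omega> s g) s\<^sub>0) - 1) / fls_X"
    by (intro laurent_expansion_intros)
  then have h: "(\<lambda>t. ?h (s\<^sub>0 + t)) has_laurent_expansion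
      (fps_to_fls (fps_expansion (\<lambda>s. \<omega> s g) s\<^sub>0) - 1) / fls_X"
    by simp
  obtain b where b: "has_vec_laurent W (\<lambda>s. ?h s \<odot>\<^bsub>W\<^esub> \<xi> s v) s\<^sub>0 b"
    using has_vec_laurent_mult[OF smooth_rep_module[OF W] a h] by blast
  \<comment> \<open>The factor \<open>s - s\<^sub>0\<close> turns \<open>?h s\<close> back into
    \<open>\<omega> s g - 1\<close> and moves the residue \<open>b (- 1)\<close> to degree 0, next
    to \<open>a 0\<close>.\<close>
  note sum = has_vec_laurent_add[OF smooth_rep_module[OF W] has_vec_laurent_shift[OF
      smooth_rep_module[OF W] b] a]
  \<comment> \<open>Injectivity is what \<open>has_vec_laurent_image\<close> asks for; the inverse
    of g undoes the action.\<close>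
  have act: "act W g \<in> lin_hom W W" "inj_on (act W g) (carrier W)"
    using g rep_act_lin[OF smooth_repD(1)[OF W]] rep_act_inv_act[OF G.is_group smooth_repD(1)[OF
        W] g] by (auto intro: inj_on_inverseI)
  \<comment> \<open>Twisted equivariance at g^-1 v gives \<open>\<omega> s g\<close> times
    \<open>\<xi> s v\<close>, and away from \<open>s\<^sub>0\<close> the denominator of
    \<open>?h\<close> cancels.\<close>
  have "\<forall>\<^sub>F s in at s\<^sub>0. act W g (\<xi> s ?v) =
      (s - s\<^sub>0) \<odot>\<^bsub>W\<^esub> (?h s \<odot>\<^bsub>W\<^esub> \<xi> s v) \<oplus>\<^bsub>W\<^esub> \<xi> s v"
    using intertwiner_holomorphic[OF v] intertwiner_holomorphic[OF v'] eventually_neq_at_within[of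
        s\<^sub>0 s\<^sub>0 UNIV]
  proof eventually_elim
    case (elim s)
    then have "\<xi> s v \<in> carrier W"
      using vec_holomorphic_at_closed[OF smooth_rep_module[OF W], of "\<lambda>s'. \<xi> s' v" s] by simp
    then have "(s - s\<^sub>0) \<odot>\<^bsub>W\<^esub> (?h s \<odot>\<^bsub>W\<^esub> \<xi> s v) \<oplus>\<^bsub>W\<^esub> \<xi> s v = \<omega> s g \<odot>\<^bsub>W\<^esub> \<xi> s v"
      using elim rep_smult_add[OF smooth_rep_module[OF W], of "\<xi> s v" "\<omega> s g - 1" 1]
      by (simp add: rep_smult_mult[OF smooth_rep_module[OF W], symmetric] rep_smult_one[OF
          smooth_rep_module[OF W]])
    then show ?case
      using elim meromorphic_intertwinerD(1)[OF \<xi> _ g v'] rep_act_act_inv[OF G.is_group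
          smooth_repD(1)[OF V] g v] by simp
  qed
  from has_vec_laurent_cong[OF smooth_rep_module[OF W] has_vec_laurent_image[OF
      smooth_rep_module[OF W] smooth_rep_module[OF W] act a'] this]
  have "(\<lambda>k. act W g (a' k)) = (\<lambda>k. b (k - 1) \<oplus>\<^bsub>W\<^esub> a k)"
    using sum by (rule has_vec_laurent_unique[OF smooth_rep_module[OF W]])
  then have "act W g (a' 0) = b (- 1) \<oplus>\<^bsub>W\<^esub> a 0"
    by (auto dest: fun_cong[of _ _ 0])
  moreover have "a' 0 \<in> carrier W" "b (- 1) \<in> carrier W" "a 0 \<in> carrier W"
    using has_vec_laurent_closed[OF smooth_rep_module[OF W]] a a' b by simp_all
  moreover have "residue_cocycle W \<omega> \<xi> s\<^sub>0 g v = b (- 1)"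
    unfolding residue_cocycle_def laurent_coeff_eq[OF smooth_rep_module[OF W] b] ..
  ultimately show ?thesis
    using rep_add_eq_iff_diff[OF smooth_rep_module[OF W], of "act W g (a' 0)" "b (- 1)" "a 0"]
        rep_act_closed[OF smooth_repD(1)[OF W] g]
    by (simp add: coboundary1_def a_def a'_def)
qed

lemma intertwiner_constant_term_eq:
  assumes "vec_holomorphic_at W (\<lambda>s. \<xi> s v) s\<^sub>0"
  shows "laurent_coeff W (\<lambda>s. \<xi> s v) s\<^sub>0 0 = \<xi> s\<^sub>0 v"
proof -
  obtain a where "has_vec_laurent W (\<lambda>s. \<xi> s v) s\<^sub>0 a" "a 0 = \<xi> s\<^sub>0 v"
    using vec_holomorphic_at_has_vec_laurent[OF smooth_rep_module[OF W] assms] .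
  then show ?thesis
    by (simp add: laurent_coeff_eq[OF smooth_rep_module[OF W]])
qed

text \<open>All vectors of U are holomorphic at \<open>s\<^sub>0\<close> and U is stable under the
  operations, so the identities for \<xi> may be evaluated at \<open>s\<^sub>0\<close> itself.
  Triviality of the character there removes the twist.\<close>

lemma intertwiner_value_G_hom:
  assumes U: "is_subrep G V U" and hol: "\<forall>u\<in>U. vec_holomorphic_at W (\<lambda>s. \<xi> s u) s\<^sub>0"
    and \<omega>1: "\<forall>g\<in>carrier G. \<omega> s\<^sub>0 g = 1"
  shows "\<xi> s\<^sub>0 \<in> G_hom G (sub_rep V U) W"
proof -
  note sub = subsetD[OF subrep_subset[OF G.is_group smooth_repD(1)[OF V] U]]
  note closed = subrep_add_closed[OF G.is_group smooth_repD(1)[OF V] U] subrep_smult_closed[OF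
      G.is_group smooth_repD(1)[OF V] U]
    subrep_act_closed[OF G.is_group smooth_repD(1)[OF V] U]
  have val: "\<xi> s\<^sub>0 u \<in> carrier W" if "u \<in> U" for u
    using vec_holomorphic_at_closed[OF smooth_rep_module[OF W]] hol that by blast
  have "\<xi> s\<^sub>0 (act V g u) = act W g (\<xi> s\<^sub>0 u)" if "g \<in> carrier G" "u \<in> U" for g u
    using meromorphic_intertwinerD(1)[OF \<xi> s\<^sub>0 that(1) sub[OF that(2)]] hol closed(3)[OF that] that \<omega>1
      rep_smult_one[OF smooth_rep_module[OF W] val[OF closed(3)[OF that]]] by simp
  moreover have "\<xi> s\<^sub>0 (u \<oplus>\<^bsub>V\<^esub> u') = \<xi> s\<^sub>0 u \<oplus>\<^bsub>W\<^esub> \<xi> s\<^sub>0 u'" if "u \<in> U" "u' \<in> U" for u u'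
    using meromorphic_intertwinerD(2)[OF \<xi> s\<^sub>0 sub[OF that(1)] sub[OF that(2)]] hol closed(1)[OF
        that] that by simp
  moreover have "\<xi> s\<^sub>0 (r \<odot>\<^bsub>V\<^esub> u) = r \<odot>\<^bsub>W\<^esub> \<xi> s\<^sub>0 u" if "u \<in> U" for r u
    using meromorphic_intertwinerD(3)[OF \<xi> s\<^sub>0 sub[OF that]] hol closed(2)[OF that] that by simp
  ultimately show ?thesis
    using val by (simp add: G_hom_def lin_hom_def sub_rep_def)
qed

end

theorem theoremA7:
  fixes G :: "('g, 'm) monoid_scheme" and T :: "'g topology"
    and D :: "complex set" and \<omega> :: "complex \<Rightarrow> 'g \<Rightarrow> complex"
    and V :: "('g, 'v) rep" and W :: "('g, 'w) rep" and U :: "'v set"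
    and \<xi> :: "complex \<Rightarrow> 'v \<Rightarrow> 'w" and s\<^sub>0 :: complex
  assumes "l_group G T" and "open D" and "holomorphic_character G T D \<omega>"
    and "smooth_rep G T V" and "admissible_rep G T W"
    and "meromorphic_intertwiner G T V W D \<omega> \<xi>"
    and "is_subrep G V U" and "s\<^sub>0 \<in> D"
    and "\<forall>u\<in>U. vec_holomorphic_at W (\<lambda>s. \<xi> s u) s\<^sub>0"
    and "\<forall>g\<in>carrier G. \<omega> s\<^sub>0 g = 1"
  shows "residue_cocycle W \<omega> \<xi> s\<^sub>0 \<in> cocycles1 G T V W \<and>
    \<xi> s\<^sub>0 \<in> G_hom G (sub_rep V U) W \<and>
    (\<exists>\<psi>\<in>cocycles1 G T (quot_rep V U) W.
       (\<forall>g\<in>carrier G. \<forall>v\<in>carrier V. \<psi> g (U +>\<^bsub>V\<^esub> v) = residue_cocycle W \<omega> \<xi> s\<^sub>0 g v) \<and>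
       ext1_ident G T (quot_rep V U) W (connecting_hom G T V U W (\<xi> s\<^sub>0)) =
         coh1_class G T (quot_rep V U) W \<psi>)"
proof (intro conjI)
  note G = assms(1) and V = assms(4) and U = assms(7)
  have W: "smooth_rep G T W"
    using assms(5) by (simp add: admissible_rep_def)
  interpret G: group G
    using G by (rule l_groupD)
  note rep_V = smooth_repD(1)[OF V] and rep_W = smooth_repD(1)[OF W]
  note ctx = G assms(2,3) V W assms(6,8)
  define \<eta> where "\<eta> = (\<lambda>v. laurent_coeff W (\<lambda>s. \<xi> s v) s\<^sub>0 0)"
  have \<eta>: "\<eta> \<in> lin_hom V W"
    unfolding \<eta>_def by (rule intertwiner_laurent_coeff_lin_hom[OF ctx])
  have res: "residue_cocycle W \<omega> \<xi> s\<^sub>0 g v = coboundary1 G V W \<eta> g v"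
    if "g \<in> carrier G" "v \<in> carrier V" for g v
    unfolding \<eta>_def using that by (rule residue_cocycle_eq_coboundary1[OF ctx])
  show "residue_cocycle W \<omega> \<xi> s\<^sub>0 \<in> cocycles1 G T V W"
    using coboundary1_cocycle[OF G V W \<eta>] rep_V res
    by (rule cocycles1_cong[OF G rep_module[OF rep_V]])
  show f: "\<xi> s\<^sub>0 \<in> G_hom G (sub_rep V U) W"
    using U assms(9,10) by (rule intertwiner_value_G_hom[OF ctx])
  define E where "E = (\<lambda>v. \<lambda>x\<in>gpow G 0. act W (x 0) (\<eta> (act V (inv\<^bsub>G\<^esub> (x 0)) v)))"
  have E: "E \<in> G_hom G V (std_res G T W 0)"
    unfolding E_def by (rule std_res_extension[OF G V W U \<eta>])
  \<comment> \<open>On U equivariance of \<open>\<xi> s\<^sub>0\<close> makes x \<eta>(x^-1 u)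
    independent of x.\<close>
  have Ef: "E u = std_aug G (\<xi> s\<^sub>0 u)" if u: "u \<in> U" for u
    unfolding E_def std_aug_def
  proof (rule restrict_ext)
    fix x assume "x \<in> gpow G 0"
    then have x: "x 0 \<in> carrier G"
      using gpow_nth by blast
    let ?u = "act V (inv\<^bsub>G\<^esub> (x 0)) u"
    have u': "?u \<in> U"
      using x u by (intro subrep_act_closed[OF G.is_group rep_V U]) auto
    then have "\<eta> ?u = \<xi> s\<^sub>0 ?u"
      unfolding \<eta>_def using assms(9) by (intro intertwiner_constant_term_eq[OF ctx]) auto
    moreover have "act W (x 0) (\<xi> s\<^sub>0 ?u) = \<xi> s\<^sub>0 (act V (x 0) ?u)"
      using f x u' by (simp add: G_hom_def sub_rep_def)
    moreover have "act V (x 0) ?u = u"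
      using subrep_subset[OF G.is_group rep_V U] u by (intro rep_act_act_inv[OF G.is_group rep_V
          x]) auto
    ultimately show "act W (x 0) (\<eta> ?u) = \<xi> s\<^sub>0 u"
      by simp
  qed
  obtain F where F: "F \<in> ext1_cocycles G T (quot_rep V U) W"
    and FE: "\<forall>v\<in>carrier V. F (U +>\<^bsub>V\<^esub> v) = std_diff G W 0 (E v)"
    using snake_cocycle_exists[OF G V W U E Ef] by blast
  note quot = smooth_rep_quot[OF G.is_group rep_V U V]
  show "\<exists>\<psi>\<in>cocycles1 G T (quot_rep V U) W.
     (\<forall>g\<in>carrier G. \<forall>v\<in>carrier V. \<psi> g (U +>\<^bsub>V\<^esub> v) = residue_cocycle W \<omega> \<xi> s\<^sub>0 g v) \<and>
     ext1_ident G T (quot_rep V U) W (connecting_hom G T V U W (\<xi> s\<^sub>0)) =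
       coh1_class G T (quot_rep V U) W \<psi>"
  \<comment> \<open>The residue cocycle on V/U is F evaluated at (1, g). Its independence of the
    representative is thus inherited from the descent of F.\<close>
  proof (intro bexI conjI ballI)
    show "(\<lambda>g y. F y (tuple2 \<one>\<^bsub>G\<^esub> g)) \<in> cocycles1 G T (quot_rep V U) W"
      by (rule ext1_cocycle_at_one[OF G quot W F])
    show "F (U +>\<^bsub>V\<^esub> v) (tuple2 \<one>\<^bsub>G\<^esub> g) = residue_cocycle W \<omega> \<xi> s\<^sub>0 g v"
      if "g \<in> carrier G" "v \<in> carrier V" for g v
      using FE that std_diff_extension[OF G V W U \<eta> that] by (simp add: res E_def)
    show "ext1_ident G T (quot_rep V U) W (connecting_hom G T V U W (\<xi> s\<^sub>0)) =
        coh1_class G T (quot_rep V U) W (\<lambda>g y. F y (tuple2 \<one>\<^bsub>G\<^esub> g))"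
      using connecting_hom_eq[OF G V W U E Ef F] FE ext1_ident_class[OF G quot W F] by simp
  qed
qed

end
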